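(* Let $n\ge 2$. The image $\pi_n(\mathcal{B}_n)$ of the braid group $\mathcal{B}_n$ under the representation $\pi_n$ is an extension of $\mathbf{E}_{n-1}^{-1}$ by the symmetric group $S_n$; that is, there is an exact sequence of groups $$1\longrightarrow \mathbf{E}_{n-1}^{-1}\longrightarrow \pi_n(\mathcal{B}_n)\longrightarrow S_n\longrightarrow 1 .$$
   Context: $\mathcal{B}_n$ is Artin's braid group with generators $\sigma_1,\dots,\sigma_{n-1}$ and relations $\sigma_i\sigma_j=\sigma_j\sigma_i$ for $|i-j|\ge 2$ and $\sigma_i\sigma_{i+1}\sigma_i=\sigma_{i+1}\sigma_i\sigma_{i+1}$ for $1\le i\le n-2$. Let $I_m$ be the $m\times m$ identity matrix and $$R=\frac{1}{\sqrt2}\begin{pmatrix}1&0&0&1\\0&1&-1&0\\0&1&1&0\\-1&0&0&1\end{pmatrix},$$ which satisfies the Yang-Baxter equation $(R\otimes I_2)(I_2\otimes R)(R\otimes I_2)=(I_2\otimes R)(R\otimes I_2)(I_2\otimes R)$. The representation $\pi_n$ of $\mathcal{B}_n$ on $(\mathbb{C}^2)^{\otimes n}$ is defined by $\pi_n(\sigma_i)=I_2^{\otimes (i-1)}\otimes R\otimes I_2^{\otimes (n-i-1)}$. Tensor products of matrices use the "left into right" convention: if $A=\begin{pmatrix}a&b\\c&d\end{pmatrix}$ then $X\otimes A=\begin{pmatrix}aX&bX\\ cX&dX\end{pmatrix}$. For $m\ge 1$ and $\nu=\pm1$, $\mathbf{E}_m^\nu$ is the abstract group generated by $x_1,\dots,x_m$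 (together with the element $-1$) with relations $x_i^2=\nu$ for $1\le i\le m$, $x_ix_j=x_jx_i$ for $|i-j|\ge 2$, and $x_{i+1}x_i=-x_ix_{i+1}$ for $1\le i\le m-1$, where $-1$ is a central element of order two. *)

theory Defs
  imports
    "Jordan_Normal_Form.Matrix"
    "HOL-Algebra.Sym_Groups"
    "HOL-Algebra.Elementary_Groups"
begin

section \<open>Groups given by generators and relations\<close>

text \<open>A letter \<open>(a, True)\<close> stands for the generator \<open>a\<close>, and \<open>(a, False)\<close> for its formal inverse.\<close>

type_synonym 'a word = "('a \<times> bool) list"

definition words :: "'a set \<Rightarrow> 'a word set" where
  "words S = lists (S \<times> UNIV)"

definition pos_word :: "'a list \<Rightarrow> 'a word" where
  "pos_word as = map (\<lambda>a. (a, True)) as"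

inductive pres_eq :: "'a set \<Rightarrow> ('a word \<times> 'a word) set \<Rightarrow> 'a word \<Rightarrow> 'a word \<Rightarrow> bool"
  for S :: "'a set" and rels :: "('a word \<times> 'a word) set" where
  refl: "u \<in> words S \<Longrightarrow> pres_eq S rels u u"
| sym: "pres_eq S rels u v \<Longrightarrow> pres_eq S rels v u"
| trans: "pres_eq S rels u v \<Longrightarrow> pres_eq S rels v w \<Longrightarrow> pres_eq S rels u w"
| cancel: "u \<in> words S \<Longrightarrow> v \<in> words S \<Longrightarrow> a \<in> S \<Longrightarrow>
    pres_eq S rels (u @ [(a, b), (a, \<not> b)] @ v) (u @ v)"
| rel: "u \<in> words S \<Longrightarrow> v \<in> words S \<Longrightarrow> (r, s) \<in> rels \<Longrightarrow> r \<in> words S \<Longrightarrow> s \<in> words S \<Longrightarrow>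
    pres_eq S rels (u @ r @ v) (u @ s @ v)"

definition pres_rel :: "'a set \<Rightarrow> ('a word \<times> 'a word) set \<Rightarrow> ('a word \<times> 'a word) set" where
  "pres_rel S rels = {(u, v). pres_eq S rels u v}"

definition presented_group ::
    "'a set \<Rightarrow> ('a word \<times> 'a word) set \<Rightarrow> 'a word set monoid" where
  "presented_group S rels =
    \<lparr> carrier = words S // pres_rel S rels,
      mult = (\<lambda>A B. \<Union>u\<in>A. \<Union>v\<in>B. pres_rel S rels `` {u @ v}),
      one = pres_rel S rels `` {[]} \<rparr>"

definition pres_gen :: "'a set \<Rightarrow> ('a word \<times> 'a word) set \<Rightarrow> 'a \<Rightarrow> 'a word set" where
  "pres_gen S rels a = pres_rel S rels `` {[(a, True)]}"

fun letter_eval :: "('b, 'c) monoid_scheme \<Rightarrow> ('a \<Rightarrow> 'b) \<Rightarrow> 'a \<times> bool \<Rightarrow> 'b" where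
  "letter_eval G f (a, b) = (if b then f a else inv\<^bsub>G\<^esub> (f a))"

fun word_eval :: "('b, 'c) monoid_scheme \<Rightarrow> ('a \<Rightarrow> 'b) \<Rightarrow> 'a word \<Rightarrow> 'b" where
  "word_eval G f [] = \<one>\<^bsub>G\<^esub>"
| "word_eval G f (x # w) = letter_eval G f x \<otimes>\<^bsub>G\<^esub> word_eval G f w"

text \<open>The homomorphism out of a presented group that is determined by the values \<open>f\<close> on the
  generators. The choice of the representative does not matter as soon as the values \<open>f\<close> satisfy
  the relations; see \<open>pres_lift_hom\<close> and \<open>pres_lift_gen\<close>.\<close>

definition pres_lift :: "('b, 'c) monoid_scheme \<Rightarrow> ('a \<Rightarrow> 'b) \<Rightarrow> 'a word set \<Rightarrow> 'b" where
  "pres_lift G f A = word_eval G f (SOME w. w \<in> A)"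

lemma words_simps [simp]:
  "[] \<in> words S" "x # u \<in> words S \<longleftrightarrow> fst x \<in> S \<and> u \<in> words S"
  "u @ v \<in> words S \<longleftrightarrow> u \<in> words S \<and> v \<in> words S"
  by (cases x, auto simp: words_def)+

lemma pres_eq_words: "pres_eq S rels u v \<Longrightarrow> u \<in> words S \<and> v \<in> words S"
  by (induction rule: pres_eq.induct) auto

lemma equiv_pres_rel: "equiv (words S) (pres_rel S rels)"
  by (rule equivI)
     (auto simp: pres_rel_def refl_on_def sym_def trans_def dest: pres_eq_words
           intro: pres_eq.refl pres_eq.sym pres_eq.trans)

lemma pres_eq_context:
  "pres_eq S rels u v \<Longrightarrow> p \<in> words S \<Longrightarrow> q \<in> words S \<Longrightarrow> pres_eq S rels (p @ u @ q) (p @ v @ q)"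
proof (induction rule: pres_eq.induct)
  case (cancel u v a b)
  show ?case using pres_eq.cancel[of "p @ u" S "v @ q" a rels b] cancel by simp
next
  case (rel u v r s)
  show ?case using pres_eq.rel[of "p @ u" S "v @ q" r s rels] rel by simp
qed (auto intro: pres_eq.intros)

lemma pres_eq_append:
  assumes "pres_eq S rels u u'" "pres_eq S rels v v'"
  shows "pres_eq S rels (u @ v) (u' @ v')"
proof -
  have "pres_eq S rels (u @ v) (u' @ v)"
    using pres_eq_context[OF assms(1), of "[]" v] pres_eq_words[OF assms(2)] by simp
  also have "pres_eq S rels (u' @ v) (u' @ v')"
    using pres_eq_context[OF assms(2), of u' "[]"] pres_eq_words[OF assms(1)] by simp
  finally (pres_eq.trans) show ?thesis .
qed

lemma presented_mult_class:
  assumes "u \<in> words S" "v \<in> words S"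
  shows "pres_rel S rels `` {u} \<otimes>\<^bsub>presented_group S rels\<^esub> pres_rel S rels `` {v}
       = pres_rel S rels `` {u @ v}"
proof -
  have "congruent2 (pres_rel S rels) (pres_rel S rels) (\<lambda>u v. pres_rel S rels `` {u @ v})"
    by (rule congruent2I', rule equiv_class_eq[OF equiv_pres_rel])
       (auto intro: pres_eq_append simp: pres_rel_def)
  from UN_equiv_class2[OF equiv_pres_rel equiv_pres_rel this assms]
  show ?thesis by (simp add: presented_group_def)
qed

lemma presented_carrierE:
  assumes "A \<in> carrier (presented_group S rels)"
  obtains u where "u \<in> words S" "A = pres_rel S rels `` {u}"
  using assms by (auto simp: presented_group_def elim: quotientE)

lemma presented_class_closed:
  "u \<in> words S \<Longrightarrow> pres_rel S rels `` {u} \<in> carrier (presented_group S rels)"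
  by (simp add: presented_group_def quotientI)

lemma presented_one: "\<one>\<^bsub>presented_group S rels\<^esub> = pres_rel S rels `` {[]}"
  by (simp add: presented_group_def)

lemma inverse_word:
  "u \<in> words S \<Longrightarrow> \<exists>v \<in> words S. pres_eq S rels (v @ u) []"
proof (induction u)
  case Nil
  show ?case by (auto intro!: bexI[of _ "[]"] pres_eq.refl)
next
  case (Cons x u)
  obtain a b where x: "x = (a, b)" by force
  from Cons obtain v where v: "v \<in> words S" "pres_eq S rels (v @ u) []" by auto
  have "pres_eq S rels (v @ [(a, \<not> b), (a, \<not> \<not> b)] @ u) (v @ u)"
    using Cons.prems v x by (intro pres_eq.cancel) auto
  from pres_eq.trans[OF this v(2)] show ?case
    using Cons.prems v x by (intro bexI[of _ "v @ [(a, \<not> b)]"]) auto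
qed

lemma group_presented: "group (presented_group S rels)"
proof (rule groupI)
  fix A B C assume "A \<in> carrier (presented_group S rels)" "B \<in> carrier (presented_group S rels)"
    "C \<in> carrier (presented_group S rels)"
  then show "A \<otimes>\<^bsub>presented_group S rels\<^esub> B \<otimes>\<^bsub>presented_group S rels\<^esub> C
    = A \<otimes>\<^bsub>presented_group S rels\<^esub> (B \<otimes>\<^bsub>presented_group S rels\<^esub> C)"
    by (elim presented_carrierE) (simp add: presented_mult_class)
next
  fix A assume "A \<in> carrier (presented_group S rels)"
  then obtain u where u: "u \<in> words S" "A = pres_rel S rels `` {u}" by (rule presented_carrierE)
  from inverse_word[OF u(1)] obtain v where v: "v \<in> words S" "pres_eq S rels (v @ u) []" by blast
  have "pres_rel S rels `` {v @ u} = pres_rel S rels `` {[]}"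
    using v by (intro equiv_class_eq[OF equiv_pres_rel]) (simp add: pres_rel_def)
  then show "\<exists>B\<in>carrier (presented_group S rels).
      B \<otimes>\<^bsub>presented_group S rels\<^esub> A = \<one>\<^bsub>presented_group S rels\<^esub>"
    using u v by (intro bexI[of _ "pres_rel S rels `` {v}"])
      (simp_all add: presented_mult_class presented_one presented_class_closed)
qed (auto elim!: presented_carrierE simp: presented_mult_class presented_one presented_class_closed)

lemma (in group) word_eval_closed:
  "f \<in> S \<rightarrow> carrier G \<Longrightarrow> u \<in> words S \<Longrightarrow> word_eval G f u \<in> carrier G"
  by (induction u) (auto simp: Pi_def)

lemma (in group) word_eval_append:
  assumes f: "f \<in> S \<rightarrow> carrier G" and uv: "u \<in> words S" "v \<in> words S"
  shows "word_eval G f (u @ v) = word_eval G f u \<otimes> word_eval G f v"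
  using uv(1)
proof (induction u)
  case (Cons x u)
  obtain a b where x: "x = (a, b)" by force
  from Cons.prems f x have "f a \<in> carrier G" by auto
  then show ?case using Cons word_eval_closed[OF f] uv(2) x by (simp add: m_assoc)
qed (use word_eval_closed[OF f uv(2)] in simp)

lemma (in group) word_eval_pres_eq:
  assumes f: "f \<in> S \<rightarrow> carrier G"
    and rels: "\<And>r s. (r, s) \<in> rels \<Longrightarrow> word_eval G f r = word_eval G f s"
  shows "pres_eq S rels u v \<Longrightarrow> word_eval G f u = word_eval G f v"
proof (induction rule: pres_eq.induct)
  case (cancel u v a b)
  have fa: "f a \<in> carrier G" using f cancel by auto
  have "word_eval G f ([(a, b), (a, \<not> b)] @ v) = word_eval G f v"
    using fa word_eval_closed[OF f] cancel by (simp add: m_assoc[symmetric])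
  moreover have "[(a, b), (a, \<not> b)] @ v \<in> words S" using cancel by simp
  ultimately show ?case using cancel
    by (simp only: word_eval_append[OF f])
next
  case (rel u v r s)
  then show ?case using rels by (simp add: word_eval_append[OF f])
qed auto

lemma (in group) pres_lift_class:
  assumes f: "f \<in> S \<rightarrow> carrier G"
    and rels: "\<And>r s. (r, s) \<in> rels \<Longrightarrow> word_eval G f r = word_eval G f s"
    and u: "u \<in> words S"
  shows "pres_lift G f (pres_rel S rels `` {u}) = word_eval G f u"
proof -
  have "u \<in> pres_rel S rels `` {u}"
    using equiv_class_self[OF equiv_pres_rel u] .
  then have "(SOME w. w \<in> pres_rel S rels `` {u}) \<in> pres_rel S rels `` {u}" by (rule someI)
  then show ?thesis unfolding pres_lift_def
    using word_eval_pres_eq[where S = S, OF f rels] by (auto simp: pres_rel_def)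
qed

lemma (in group) pres_lift_hom:
  assumes f: "f \<in> S \<rightarrow> carrier G"
    and rels: "\<And>r s. (r, s) \<in> rels \<Longrightarrow> word_eval G f r = word_eval G f s"
  shows "pres_lift G f \<in> hom (presented_group S rels) G"
proof (rule homI)
  fix A assume "A \<in> carrier (presented_group S rels)"
  then show "pres_lift G f A \<in> carrier G"
    by (elim presented_carrierE) (simp add: pres_lift_class[OF assms] word_eval_closed[OF f])
next
  fix A B assume "A \<in> carrier (presented_group S rels)" "B \<in> carrier (presented_group S rels)"
  then show "pres_lift G f (A \<otimes>\<^bsub>presented_group S rels\<^esub> B) = pres_lift G f A \<otimes> pres_lift G f B"
    by (elim presented_carrierE)
       (simp add: presented_mult_class pres_lift_class[OF assms] word_eval_append[OF f])
qed

lemma (in group) pres_lift_gen: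
  assumes f: "f \<in> S \<rightarrow> carrier G"
    and rels: "\<And>r s. (r, s) \<in> rels \<Longrightarrow> word_eval G f r = word_eval G f s"
    and a: "a \<in> S"
  shows "pres_lift G f (pres_gen S rels a) = f a"
proof -
  have "f a \<in> carrier G" using f a by auto
  then show ?thesis unfolding pres_gen_def
    by (subst pres_lift_class[OF assms(1,2)]) (use a in auto)
qed


section \<open>Artin's braid group\<close>

definition braid_rels :: "nat \<Rightarrow> (nat word \<times> nat word) set" where
  "braid_rels n =
     {(pos_word [i, j], pos_word [j, i]) | i j.
        i \<in> {1..n-1} \<and> j \<in> {1..n-1} \<and> \<bar>int i - int j\<bar> \<ge> 2} \<union>
     {(pos_word [i, i+1, i], pos_word [i+1, i, i+1]) | i. i \<in> {1..n-2}}"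

definition braid_group :: "nat \<Rightarrow> nat word set monoid" where
  "braid_group n = presented_group {1..n-1} (braid_rels n)"

definition sigma :: "nat \<Rightarrow> nat \<Rightarrow> nat word set" where
  "sigma n i = pres_gen {1..n-1} (braid_rels n) i"


section \<open>The groups \<open>E\<close>\<close>

datatype egen = Minus_one | X nat

text \<open>The word representing \<open>\<nu> = \<plusminus>1\<close>.\<close>

definition sign_word :: "int \<Rightarrow> egen word" where
  "sign_word \<nu> = (if \<nu> = 1 then [] else pos_word [Minus_one])"

definition E_gens :: "nat \<Rightarrow> egen set" where
  "E_gens m = insert Minus_one (X ` {1..m})"

definition E_rels :: "nat \<Rightarrow> int \<Rightarrow> (egen word \<times> egen word) set" where
  "E_rels m \<nu> =
     {(pos_word [Minus_one, Minus_one], [])} \<union>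
     {(pos_word [Minus_one, X i], pos_word [X i, Minus_one]) | i. i \<in> {1..m}} \<union>
     {(pos_word [X i, X i], sign_word \<nu>) | i. i \<in> {1..m}} \<union>
     {(pos_word [X i, X j], pos_word [X j, X i]) | i j.
        i \<in> {1..m} \<and> j \<in> {1..m} \<and> \<bar>int i - int j\<bar> \<ge> 2} \<union>
     {(pos_word [X (i+1), X i], pos_word [Minus_one, X i, X (i+1)]) | i. i \<in> {1..m-1}}"

text \<open>Intended for \<open>\<nu> \<in> {1, -1}\<close> only.\<close>

definition E_group :: "nat \<Rightarrow> int \<Rightarrow> egen word set monoid" where
  "E_group m \<nu> = presented_group (E_gens m) (E_rels m \<nu>)"


section \<open>The representation of the braid group\<close>

text \<open>Tensor product with the ``left into right'' convention: the block of \<open>kron A B\<close> in block row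
  \<open>k\<close> and block column \<open>l\<close> is \<open>B $$ (k, l)\<close> times \<open>A\<close>.\<close>

definition kron :: "'a :: comm_ring_1 mat \<Rightarrow> 'a mat \<Rightarrow> 'a mat" where
  "kron A B = mat (dim_row A * dim_row B) (dim_col A * dim_col B)
     (\<lambda>(i, j). B $$ (i div dim_row A, j div dim_col A) * A $$ (i mod dim_row A, j mod dim_col A))"

fun kron_pow :: "'a :: comm_ring_1 mat \<Rightarrow> nat \<Rightarrow> 'a mat" where
  "kron_pow A 0 = 1\<^sub>m 1"
| "kron_pow A (Suc k) = kron (kron_pow A k) A"

definition R_mat :: "complex mat" where
  "R_mat = complex_of_real (1 / sqrt 2) \<cdot>\<^sub>m mat_of_rows_list 4
     [[ 1, 0,  0, 1],
      [ 0, 1, -1, 0],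
      [ 0, 1,  1, 0],
      [-1, 0,  0, 1]]"

definition GL :: "nat \<Rightarrow> complex mat monoid" where
  "GL N = units_of (ring_mat TYPE(complex) N ())"

definition sigma_mat :: "nat \<Rightarrow> nat \<Rightarrow> complex mat" where
  "sigma_mat n i = kron (kron (kron_pow (1\<^sub>m 2) (i - 1)) R_mat) (kron_pow (1\<^sub>m 2) (n - i - 1))"

definition braid_rep :: "nat \<Rightarrow> nat word set \<Rightarrow> complex mat" where
  "braid_rep n = pres_lift (GL (2 ^ n)) (sigma_mat n)"

definition braid_image :: "nat \<Rightarrow> complex mat monoid" where
  "braid_image n = (GL (2 ^ n)) \<lparr> carrier := braid_rep n ` carrier (braid_group n) \<rparr>"


text \<open>The matrices satisfy the braid relations, so \<open>braid_rep n\<close> is a homomorphism with the intended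
  values on the generators.\<close>

lemma kron_dim [simp]:
  "dim_row (kron A B) = dim_row A * dim_row B" "dim_col (kron A B) = dim_col A * dim_col B"
  by (simp_all add: kron_def)

lemma kron_carrier:
  "A \<in> carrier_mat a b \<Longrightarrow> B \<in> carrier_mat c d \<Longrightarrow> kron A B \<in> carrier_mat (a * c) (b * d)"
  by auto

lemma kron_index:
  "i < dim_row A * dim_row B \<Longrightarrow> j < dim_col A * dim_col B \<Longrightarrow>
   kron A B $$ (i, j) =
     B $$ (i div dim_row A, j div dim_col A) * A $$ (i mod dim_row A, j mod dim_col A)"
  by (simp add: kron_def)

lemma div_less_nat: "i < a * b \<Longrightarrow> i div a < (b :: nat)"
  by (simp add: less_mult_imp_div_less mult.commute)

lemma mod_less_nat: "i < a * b \<Longrightarrow> i mod a < (a :: nat)"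
  by (cases "a = 0") auto

lemma kron_assoc: "kron (kron A B) C = kron A (kron B C)"
proof (rule eq_matI)
  fix i j assume "i < dim_row (kron A (kron B C))" "j < dim_col (kron A (kron B C))"
  then have i: "i < (dim_row A * dim_row B) * dim_row C" "i < dim_row A * (dim_row B * dim_row C)"
    and j: "j < (dim_col A * dim_col B) * dim_col C" "j < dim_col A * (dim_col B * dim_col C)"
    by (simp_all add: mult.assoc)
  note facts = div_less_nat[OF i(1)] div_less_nat[OF j(1)] div_less_nat[OF i(2)]
    div_less_nat[OF j(2)] mod_less_nat[OF i(1)] mod_less_nat[OF j(1)] i j
  have mm: "x mod (a * b) mod a = x mod (a :: nat)" for x a b by (simp add: mod_mod_cancel)
  have md: "x mod (a * b) div a = x div a mod (b :: nat)" for x a b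
    by (cases "a = 0") (simp_all add: mod_mult2_eq)
  show "kron (kron A B) C $$ (i, j) = kron A (kron B C) $$ (i, j)"
    using facts by (simp add: kron_index mm md div_mult2_eq ac_simps)
qed (simp_all add: mult.assoc)

lemma kron_one_left [simp]: "kron (1\<^sub>m 1) A = A"
  by (rule eq_matI) (simp_all add: kron_index)

lemma kron_one_right [simp]: "kron A (1\<^sub>m 1) = A"
  by (rule eq_matI) (auto simp: kron_index)

lemma kron_one: "kron (1\<^sub>m a) (1\<^sub>m b) = 1\<^sub>m (a * b)"
proof (rule eq_matI)
  fix i j assume ij: "i < dim_row (1\<^sub>m (a * b))" "j < dim_col (1\<^sub>m (a * b))"
  have "i div a = j div a \<and> i mod a = j mod a \<longleftrightarrow> i = j"
    by (metis div_mult_mod_eq)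
  with ij show "kron (1\<^sub>m a) (1\<^sub>m b) $$ (i, j) = 1\<^sub>m (a * b) $$ (i, j)"
    by (auto simp: kron_index div_less_nat mod_less_nat)
qed auto

lemma kron_pow_one: "kron_pow (1\<^sub>m 2) k = 1\<^sub>m (2 ^ k)"
  by (induction k) (simp_all add: kron_one mult.commute)

lemma sum_div_mod:
  fixes a b :: nat and f g :: "nat \<Rightarrow> 'a :: comm_ring_1"
  shows "(\<Sum>k\<in>{0..<a * b}. g (k div a) * f (k mod a)) =
   (\<Sum>k\<in>{0..<b}. g k) * (\<Sum>k\<in>{0..<a}. f k)"
proof -
  have "(\<Sum>k\<in>{0..<b} \<times> {0..<a}. g (fst k) * f (snd k)) =
        (\<Sum>k\<in>{0..<a * b}. g (k div a) * f (k mod a))"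
  proof (rule sum.reindex_bij_witness[of _ "\<lambda>k. (k div a, k mod a)" "\<lambda>(q, r). q * a + r"])
    fix x assume x: "x \<in> {0..<b} \<times> {0..<a}"
    then obtain q r where qr: "x = (q, r)" "q < b" "r < a" by auto
    have "q * a + r < Suc q * a" using qr by simp
    also have "\<dots> \<le> b * a" using qr by (intro mult_right_mono) auto
    finally show "(case x of (q, r) \<Rightarrow> q * a + r) \<in> {0..<a * b}" using qr by (simp add: mult.commute)
  qed (auto simp: div_less_nat mod_less_nat)
  then show ?thesis by (simp add: sum_product sum.cartesian_product case_prod_beta)
qed

lemma kron_mult:
  assumes "A \<in> carrier_mat a b" "B \<in> carrier_mat b c" "C \<in> carrier_mat d e" "D \<in> carrier_mat e f"
  shows "kron A C * kron B D = kron (A * B) (C * D)"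
proof (rule eq_matI)
  fix i j assume "i < dim_row (kron (A * B) (C * D))" "j < dim_col (kron (A * B) (C * D))"
  with assms have i: "i < a * d" and j: "j < c * f" by auto
  note facts = div_less_nat[OF i] div_less_nat[OF j] mod_less_nat[OF i] mod_less_nat[OF j]
  have "(kron A C * kron B D) $$ (i, j) =
    (\<Sum>k\<in>{0..<b * e}. kron A C $$ (i, k) * kron B D $$ (k, j))"
    using i j assms by (simp add: scalar_prod_def)
  also have "\<dots> = (\<Sum>k\<in>{0..<b * e}. (C $$ (i div a, k div b) * D $$ (k div b, j div c)) *
      (A $$ (i mod a, k mod b) * B $$ (k mod b, j mod c)))"
    using i j assms by (intro sum.cong) (auto simp: kron_index)
  also have "\<dots> = (\<Sum>k\<in>{0..<e}. C $$ (i div a, k) * D $$ (k, j div c)) *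
      (\<Sum>k\<in>{0..<b}. A $$ (i mod a, k) * B $$ (k, j mod c))"
    by (rule sum_div_mod)
  also have "\<dots> = kron (A * B) (C * D) $$ (i, j)"
    using i j facts assms by (simp add: kron_index scalar_prod_def)
  finally show "(kron A C * kron B D) $$ (i, j) = kron (A * B) (C * D) $$ (i, j)" .
qed (use assms in auto)

lemma kron_smult_left: "kron (c \<cdot>\<^sub>m A) B = c \<cdot>\<^sub>m kron A B"
  by (rule eq_matI) (auto simp: kron_index div_less_nat mod_less_nat)

lemma kron_smult_right: "kron A (c \<cdot>\<^sub>m B) = c \<cdot>\<^sub>m kron A B"
  by (rule eq_matI) (auto simp: kron_index div_less_nat mod_less_nat)

lemma kron_add_left:
  assumes "A \<in> carrier_mat a b" "B \<in> carrier_mat a b"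
  shows "kron (A + B) C = kron A C + kron B C"
  using assms by (intro eq_matI) (auto simp: kron_index div_less_nat mod_less_nat algebra_simps)

lemma kron_add_right:
  assumes "A \<in> carrier_mat a b" "B \<in> carrier_mat a b"
  shows "kron C (A + B) = kron C A + kron C B"
  using assms by (intro eq_matI) (auto simp: kron_index div_less_nat mod_less_nat algebra_simps)

lemma smult_smult_mat: "a \<cdot>\<^sub>m (b \<cdot>\<^sub>m A) = (a * b :: 'a :: comm_ring_1) \<cdot>\<^sub>m A"
  by (rule eq_matI) (auto simp: mult.assoc)

lemma smult_mult3:
  fixes c :: "'a :: comm_ring_1"
  assumes "A \<in> carrier_mat N N" "B \<in> carrier_mat N N" "C \<in> carrier_mat N N"
  shows "(c \<cdot>\<^sub>m A) * (c \<cdot>\<^sub>m B) * (c \<cdot>\<^sub>m C) = (c * (c * c)) \<cdot>\<^sub>m (A * B * C)"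
proof -
  have "(c \<cdot>\<^sub>m A) * (c \<cdot>\<^sub>m B) = c \<cdot>\<^sub>m (c \<cdot>\<^sub>m (A * B))"
    using assms by (simp add: mult_smult_assoc_mat[of _ N N _ N] mult_smult_distrib[of _ N N _ N])
  moreover have "A * B \<in> carrier_mat N N" using assms by simp
  ultimately show ?thesis using assms
    by (simp add: mult_smult_assoc_mat[of _ N N _ N] mult_smult_distrib[of _ N N _ N]
        smult_smult_mat mult.assoc)
qed

context
begin

private definition J :: "complex mat" where
  "J = mat_of_rows_list 2 [[0, 1], [-1, 0]]"

private definition K :: "complex mat" where
  "K = mat_of_rows_list 2 [[0, 1], [1, 0]]"

private definition M :: "complex mat" where
  "M = kron J K"

private lemma JK_carrier: "J \<in> carrier_mat 2 2" "K \<in> carrier_mat 2 2"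
  by (rule carrier_matI; simp add: J_def K_def mat_of_rows_list_def)+

private lemma M_carrier: "M \<in> carrier_mat 4 4"
  using kron_carrier[OF JK_carrier] by (simp add: M_def)

private lemma JK_mult: "J * J = (-1) \<cdot>\<^sub>m 1\<^sub>m 2" "K * K = 1\<^sub>m 2" "K * J = (-1) \<cdot>\<^sub>m (J * K)"
  by (rule eq_matI; auto simp: J_def K_def mat_of_rows_list_def scalar_prod_def less_Suc_eq
      numeral_2_eq_2)+

private lemma M_square: "M * M = (-1) \<cdot>\<^sub>m 1\<^sub>m 4"
  by (simp add: M_def kron_mult[OF JK_carrier(1,1,2,2)] JK_mult kron_smult_left kron_one)

private lemma R_mat_M: "R_mat = complex_of_real (1 / sqrt 2) \<cdot>\<^sub>m (1\<^sub>m 4 + M)"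
proof -
  have less_4: "i < (4 :: nat) \<longleftrightarrow> i = 0 \<or> i = 1 \<or> i = 2 \<or> i = 3" for i by presburger
  have ent: "J $$ (0, 0) = 0" "J $$ (0, 1) = 1" "J $$ (1, 0) = -1" "J $$ (1, 1) = 0"
    "K $$ (0, 0) = 0" "K $$ (0, 1) = 1" "K $$ (1, 0) = 1" "K $$ (1, 1) = 0"
    by (simp_all add: J_def K_def mat_of_rows_list_def)
  have dim: "dim_row J = 2" "dim_col J = 2" "dim_row K = 2" "dim_col K = 2"
    using JK_carrier by auto
  have "mat_of_rows_list 4 [[1, 0, 0, 1], [0, 1, -1, 0], [0, 1, 1, 0], [-1, 0, 0, 1]] = 1\<^sub>m 4 + M"
    (is "?L = _")
  proof (rule eq_matI)
    fix i j assume "i < dim_row (1\<^sub>m 4 + M)" "j < dim_col (1\<^sub>m 4 + M)"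
    then have i: "i < 4" and j: "j < 4" using M_carrier by auto
    have "?L $$ (i, j) = [[1, 0, 0, 1], [0, 1, -1, 0], [0, 1, 1, 0], [-1, 0, 0, 1]] ! i ! j"
      using i j by (simp add: mat_of_rows_list_def)
    also have "\<dots> = (if i = j then 1 else 0) + K $$ (i div 2, j div 2) * J $$ (i mod 2, j mod 2)"
      using i j unfolding less_4
      by (elim disjE) (simp_all add: ent ent[unfolded One_nat_def])
    also have "\<dots> = (1\<^sub>m 4 + M) $$ (i, j)"
      using i j M_carrier by (simp add: M_def kron_index dim)
    finally show "?L $$ (i, j) = (1\<^sub>m 4 + M) $$ (i, j)" .
  qed (use M_carrier in \<open>auto simp: mat_of_rows_list_def\<close>)
  then show ?thesis by (simp add: R_mat_def)
qed

lemma R_mat_carrier: "R_mat \<in> carrier_mat 4 4"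
  using M_carrier by (simp add: R_mat_M)

private lemma braid_identity:
  fixes x y :: "complex mat"
  assumes car: "x \<in> carrier_mat N N" "y \<in> carrier_mat N N"
    and xx: "x * x = (-1) \<cdot>\<^sub>m 1\<^sub>m N" and yx: "y * x = (-1) \<cdot>\<^sub>m (x * y)"
  shows "(1\<^sub>m N + x) * (1\<^sub>m N + y) * (1\<^sub>m N + x) = (x + y) + (x + y)"
proof -
  have z: "x * y \<in> carrier_mat N N" using car by simp
  have "x * y * x = x * (y * x)" using car by (intro assoc_mult_mat)
  also have "\<dots> = (-1) \<cdot>\<^sub>m (x * (x * y))"
    unfolding yx using car z by (intro mult_smult_distrib)
  also have "x * (x * y) = x * x * y" using car by (intro assoc_mult_mat[symmetric])
  also have "\<dots> = (-1) \<cdot>\<^sub>m (1\<^sub>m N * y)"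
    unfolding xx using car by (intro mult_smult_assoc_mat[of _ N N]) auto
  also have "(-1) \<cdot>\<^sub>m \<dots> = y" using car by (intro eq_matI) auto
  finally have zx: "x * y * x = y" .
  have 1: "(1\<^sub>m N + x) * (1\<^sub>m N + y) = 1\<^sub>m N + x + (y + x * y)"
    using car z by (simp add: add_mult_distrib_mat[of _ N N _ _ N] mult_add_distrib_mat[of _ N N _ N])
  let ?S = "1\<^sub>m N + x + (y + x * y)"
  have "?S * (1\<^sub>m N + x) = ?S * 1\<^sub>m N + ?S * x"
    using car z by (intro mult_add_distrib_mat) auto
  also have "?S * 1\<^sub>m N = ?S" using car z by (intro right_mult_one_mat) auto
  also have "?S * x = (1\<^sub>m N + x) * x + (y + x * y) * x"
    using car z by (intro add_mult_distrib_mat) auto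
  also have "(1\<^sub>m N + x) * x = 1\<^sub>m N * x + x * x"
    using car z by (intro add_mult_distrib_mat) auto
  also have "1\<^sub>m N * x = x" using car by (intro left_mult_one_mat) auto
  also have "(y + x * y) * x = y * x + x * y * x"
    using car z by (intro add_mult_distrib_mat) auto
  finally have 2: "?S * (1\<^sub>m N + x) = ?S + (x + x * x + (y * x + x * y * x))" .
  obtain w where w: "x * y = w" by blast
  have "w \<in> carrier_mat N N" using z by (simp add: w)
  then show ?thesis unfolding 1 2 unfolding zx xx yx unfolding w
    using car by (intro eq_matI) auto
qed

lemma yang_baxter:
  "kron R_mat (1\<^sub>m 2) * kron (1\<^sub>m 2) R_mat * kron R_mat (1\<^sub>m 2) =
   kron (1\<^sub>m 2) R_mat * kron R_mat (1\<^sub>m 2) * kron (1\<^sub>m 2) R_mat"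
proof -
  define x where "x = kron M (1\<^sub>m 2)"
  define y where "y = kron (1\<^sub>m 2) M"
  have I: "1\<^sub>m 2 \<in> carrier_mat 2 (2 :: nat)" by simp
  have car: "x \<in> carrier_mat 8 8" "y \<in> carrier_mat 8 8"
    using kron_carrier[OF M_carrier I] kron_carrier[OF I M_carrier] by (simp_all add: x_def y_def)
  have xx: "x * x = (-1) \<cdot>\<^sub>m 1\<^sub>m 8"
    by (simp add: x_def kron_mult[OF M_carrier M_carrier I I] M_square kron_smult_left kron_one)
  have yy: "y * y = (-1) \<cdot>\<^sub>m 1\<^sub>m 8"
    by (simp add: y_def kron_mult[OF I I M_carrier M_carrier] M_square kron_smult_right kron_one)
  have x': "x = kron J (kron K (1\<^sub>m 2))" by (simp add: x_def M_def kron_assoc)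
  have y': "y = kron (1\<^sub>m 2) (kron J K)" by (simp add: y_def M_def)
  note c = JK_carrier I kron_carrier[OF JK_carrier(2) I] kron_carrier[OF JK_carrier]
  have xy: "x * y = kron J (kron (K * J) K)"
    unfolding x' y' kron_mult[OF c(1,3,4,5)] kron_mult[OF c(2,1,3,2)] using JK_carrier by simp
  have yx': "y * x = kron J (kron (J * K) K)"
    unfolding x' y' kron_mult[OF c(3,1,5,4)] kron_mult[OF c(1,2,2,3)] using JK_carrier by simp
  have xy': "x * y = (-1) \<cdot>\<^sub>m (y * x)"
    unfolding xy yx' JK_mult kron_smult_left kron_smult_right ..
  have yx: "y * x = (-1) \<cdot>\<^sub>m (x * y)"
    unfolding xy' smult_smult_mat by (rule eq_matI) (auto simp del: index_mult_mat(1))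
  have Rx: "kron R_mat (1\<^sub>m 2) = complex_of_real (1 / sqrt 2) \<cdot>\<^sub>m (1\<^sub>m 8 + x)"
    unfolding R_mat_M kron_smult_left x_def using M_carrier
    by (simp add: kron_add_left[of _ 4 4] kron_one)
  have Ry: "kron (1\<^sub>m 2) R_mat = complex_of_real (1 / sqrt 2) \<cdot>\<^sub>m (1\<^sub>m 8 + y)"
    unfolding R_mat_M kron_smult_right y_def using M_carrier
    by (simp add: kron_add_right[of _ 4 4] kron_one)
  have "(1\<^sub>m 8 + x) * (1\<^sub>m 8 + y) * (1\<^sub>m 8 + x) = (1\<^sub>m 8 + y) * (1\<^sub>m 8 + x) * (1\<^sub>m 8 + y)"
    unfolding braid_identity[OF car xx yx] braid_identity[OF car(2,1) yy xy']
    unfolding comm_add_mat[OF car] ..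
  then show ?thesis unfolding Rx Ry
    using car by (simp only: smult_mult3[of _ 8] add_carrier_mat one_carrier_mat)
qed

lemma R_mat_inverse: "\<exists>R'\<in>carrier_mat 4 4. R' * R_mat = 1\<^sub>m 4 \<and> R_mat * R' = 1\<^sub>m 4"
proof -
  let ?c = "complex_of_real (1 / sqrt 2)"
  have "?c * ?c = 1 / 2" by (simp flip: of_real_mult)
  then have c: "?c * (?c * 2) = 1" by (simp only: mult.assoc[symmetric]) simp
  have one: "1 \<cdot>\<^sub>m 1\<^sub>m 4 = (1\<^sub>m 4 :: complex mat)" by (rule eq_matI) auto
  have inv: "(?c \<cdot>\<^sub>m (1\<^sub>m 4 + s \<cdot>\<^sub>m M)) * (?c \<cdot>\<^sub>m (1\<^sub>m 4 + (-s) \<cdot>\<^sub>m M)) = 1\<^sub>m 4" if "s * s = 1" for s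
  proof -
    have "(1\<^sub>m 4 + s \<cdot>\<^sub>m M) * (1\<^sub>m 4 + (-s) \<cdot>\<^sub>m M) =
        1\<^sub>m 4 + s \<cdot>\<^sub>m M + (-s) \<cdot>\<^sub>m (M + s \<cdot>\<^sub>m (M * M))"
      using M_carrier
      by (simp add: add_mult_distrib_mat[of _ 4 4 _ _ 4] mult_add_distrib_mat[of _ 4 4 _ 4]
          mult_smult_assoc_mat[of _ 4 4 _ 4] mult_smult_distrib[of _ 4 4 _ 4] smult_smult_mat)
    also have "\<dots> = 2 \<cdot>\<^sub>m 1\<^sub>m 4"
      unfolding M_square using M_carrier that by (intro eq_matI) (auto simp: algebra_simps)
    finally show ?thesis using M_carrier
      by (simp add: mult_smult_assoc_mat[of _ 4 4 _ 4] mult_smult_distrib[of _ 4 4 _ 4]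
          smult_smult_mat c one del: of_real_divide)
  qed
  have "R_mat = ?c \<cdot>\<^sub>m (1\<^sub>m 4 + 1 \<cdot>\<^sub>m M)"
    unfolding R_mat_M using M_carrier by (intro eq_matI) auto
  then show ?thesis using inv[of 1] inv[of "-1"] M_carrier
    by (intro bexI[of _ "?c \<cdot>\<^sub>m (1\<^sub>m 4 + (-1) \<cdot>\<^sub>m M)"]) auto
qed

end

lemma carrier_GL: "carrier (GL N) = Units (ring_mat TYPE(complex) N ())"
  by (simp add: GL_def units_of_def)

lemma mult_GL: "A \<otimes>\<^bsub>GL N\<^esub> B = A * B"
  by (simp add: GL_def units_of_def ring_mat_def)

lemma one_GL: "\<one>\<^bsub>GL N\<^esub> = 1\<^sub>m N"
  by (simp add: GL_def units_of_def ring_mat_def)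

lemma GL_iff: "A \<in> carrier (GL N) \<longleftrightarrow>
  A \<in> carrier_mat N N \<and> (\<exists>B\<in>carrier_mat N N. B * A = 1\<^sub>m N \<and> A * B = 1\<^sub>m N)"
  by (auto simp: carrier_GL Units_def ring_mat_def)

lemma group_GL: "group (GL N)"
proof -
  interpret semiring "ring_mat TYPE(complex) N ()" by (rule semiring_mat)
  show ?thesis unfolding GL_def by (rule units_group)
qed

lemma sigma_mat_GL:
  assumes "i \<in> {1..n-1}"
  shows "sigma_mat n i \<in> carrier (GL (2 ^ n))"
proof -
  obtain R' where R': "R' \<in> carrier_mat 4 4" "R' * R_mat = 1\<^sub>m 4" "R_mat * R' = 1\<^sub>m 4"
    using R_mat_inverse by blast
  define a b where "a = i - 1" and "b = n - i - 1"
  have "n = a + 2 + b" using assms by (auto simp: a_def b_def)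
  then have N: "2 ^ n = 2 ^ a * 4 * (2 ^ b :: nat)" by (simp add: power_add)
  let ?K = "\<lambda>M :: complex mat. kron (kron (1\<^sub>m (2 ^ a)) M) (1\<^sub>m (2 ^ b))"
  have car: "?K M \<in> carrier_mat (2 ^ n) (2 ^ n)" if "M \<in> carrier_mat 4 4" for M
    unfolding N by (intro kron_carrier that) auto
  have mult: "?K M * ?K M' = ?K (M * M')" if "M \<in> carrier_mat 4 4" "M' \<in> carrier_mat 4 4" for M M'
    using that
    by (subst kron_mult[of _ "2 ^ a * 4" "2 ^ a * 4" _ "2 ^ a * 4" _ "2 ^ b" "2 ^ b" _ "2 ^ b"])
       (auto intro!: kron_carrier simp: kron_mult[of _ "2 ^ a" "2 ^ a" _ "2 ^ a" _ 4 4 _ 4])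
  have one: "?K (1\<^sub>m 4) = 1\<^sub>m (2 ^ n)" unfolding N by (simp add: kron_one)
  have "sigma_mat n i = ?K R_mat" by (simp add: sigma_mat_def kron_pow_one a_def b_def)
  then show ?thesis unfolding GL_iff
    using car[OF R_mat_carrier] car[OF R'(1)] mult[OF R'(1) R_mat_carrier]
      mult[OF R_mat_carrier R'(1)] R' one by auto
qed

lemma sigma_mat_far:
  assumes "1 \<le> i" "i + 2 \<le> j" "j \<le> n - 1"
  shows "sigma_mat n i * sigma_mat n j = sigma_mat n j * sigma_mat n i"
proof -
  define a b c where "a = i - 1" and "b = j - i - 2" and "c = n - j - 1"
  have e: "j - 1 = a + 2 + b" "n - i - 1 = b + 2 + c"
    using assms by (auto simp: a_def b_def c_def)
  let ?I = "\<lambda>k. 1\<^sub>m (2 ^ k) :: complex mat"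
  have I4: "?I (x + 2 + y) = kron (kron (?I x) (1\<^sub>m 4)) (?I y)" for x y
    by (simp add: kron_one power_add ac_simps)
  have I4': "?I (x + 2 + y) = kron (?I x) (kron (1\<^sub>m 4) (?I y))" for x y
    by (simp add: kron_one power_add ac_simps)
  define U where "U = kron (kron (?I a) R_mat) (?I b)"
  define J where "J = kron (kron (?I a) (1\<^sub>m 4)) (?I b)"
  define V where "V = kron R_mat (?I c)"
  define L where "L = kron (1\<^sub>m 4 :: complex mat) (?I c)"
  have i: "sigma_mat n i = kron U L"
    unfolding sigma_mat_def kron_pow_one e I4' U_def L_def a_def[symmetric] kron_assoc ..
  have j: "sigma_mat n j = kron J V"
    unfolding sigma_mat_def kron_pow_one e I4 J_def V_def c_def[symmetric] kron_assoc ..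
  let ?d = "2 ^ a * 4 * 2 ^ b" and ?e = "4 * 2 ^ c"
  have car: "U \<in> carrier_mat ?d ?d" "J \<in> carrier_mat ?d ?d" "V \<in> carrier_mat ?e ?e"
    "L \<in> carrier_mat ?e ?e"
    unfolding U_def J_def V_def L_def by (intro kron_carrier R_mat_carrier; simp)+
  have JL: "J = 1\<^sub>m ?d" "L = 1\<^sub>m ?e" by (simp_all add: J_def L_def kron_one)
  have UJ: "U * J = J * U" "L * V = V * L"
    unfolding JL using car(1,3)
    by (simp_all only: left_mult_one_mat right_mult_one_mat)
  show ?thesis unfolding i j
    by (simp add: kron_mult[OF car(1,2,4,3)] kron_mult[OF car(2,1,3,4)] UJ)
qed

lemma sigma_mat_braid:
  assumes "i \<in> {1..n-2}"
  shows "sigma_mat n i * sigma_mat n (i+1) * sigma_mat n i =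
         sigma_mat n (i+1) * sigma_mat n i * sigma_mat n (i+1)"
proof -
  define a b where "a = i - 1" and "b = n - i - 2"
  have e: "i + 1 - 1 = a + 1" "n - i - 1 = 1 + b" "n - (i + 1) - 1 = b"
    using assms by (auto simp: a_def b_def)
  let ?I = "\<lambda>k. 1\<^sub>m (2 ^ k) :: complex mat"
  let ?K = "\<lambda>M. kron (?I a) (kron M (?I b))"
  let ?U = "kron R_mat (1\<^sub>m 2)" and ?V = "kron (1\<^sub>m 2) R_mat"
  have I: "?I (x + 1) = kron (?I x) (1\<^sub>m 2)" "?I (1 + x) = kron (1\<^sub>m 2) (?I x)" for x
    by (simp_all add: kron_one mult.commute)
  have i: "sigma_mat n i = ?K ?U"
    unfolding sigma_mat_def kron_pow_one e I a_def[symmetric] kron_assoc ..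
  have j: "sigma_mat n (i+1) = ?K ?V"
    unfolding sigma_mat_def kron_pow_one e I b_def[symmetric] kron_assoc ..
  have car: "?U \<in> carrier_mat 8 8" "?V \<in> carrier_mat 8 8"
    using kron_carrier[OF R_mat_carrier, of "1\<^sub>m 2" 2 2]
      kron_carrier[OF _ R_mat_carrier, of "1\<^sub>m 2" 2 2] by simp_all
  have mult: "?K M * ?K M' = ?K (M * M')" if "M \<in> carrier_mat 8 8" "M' \<in> carrier_mat 8 8" for M M'
    using that
    by (subst kron_mult[of _ "2 ^ a" "2 ^ a" _ "2 ^ a" _ "8 * 2 ^ b" "8 * 2 ^ b" _ "8 * 2 ^ b"])
       (auto intro!: kron_carrier simp: kron_mult[of _ 8 8 _ 8 _ "2 ^ b" "2 ^ b" _ "2 ^ b"])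
  have UV: "?U * ?V \<in> carrier_mat 8 8" "?V * ?U \<in> carrier_mat 8 8"
    using mult_carrier_mat[OF car] mult_carrier_mat[OF car(2,1)] by simp_all
  show ?thesis unfolding i j
    by (simp only: mult[OF car] mult[OF car(2,1)] mult[OF UV(1) car(1)] mult[OF UV(2) car(2)]
        yang_baxter)
qed

lemma sigma_mat_rels:
  assumes "(r, s) \<in> braid_rels n"
  shows "word_eval (GL (2 ^ n)) (sigma_mat n) r = word_eval (GL (2 ^ n)) (sigma_mat n) s"
proof -
  interpret group "GL (2 ^ n)" by (rule group_GL)
  note S = sigma_mat_GL
  from assms consider
    (far) i j where "i \<in> {1..n-1}" "j \<in> {1..n-1}" "\<bar>int i - int j\<bar> \<ge> 2"
      "r = pos_word [i, j]" "s = pos_word [j, i]"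
  | (braid) i where "i \<in> {1..n-2}" "r = pos_word [i, i+1, i]" "s = pos_word [i+1, i, i+1]"
    unfolding braid_rels_def by blast
  then show ?thesis
  proof cases
    case far
    then have "i + 2 \<le> j \<or> j + 2 \<le> i" by linarith
    then have "sigma_mat n i \<otimes>\<^bsub>GL (2 ^ n)\<^esub> sigma_mat n j =
        sigma_mat n j \<otimes>\<^bsub>GL (2 ^ n)\<^esub> sigma_mat n i"
      unfolding mult_GL using sigma_mat_far[of i j n] sigma_mat_far[of j i n] far by auto
    then show ?thesis using far S by (simp add: pos_word_def)
  next
    case braid
    then have "i \<in> {1..n-1}" "i + 1 \<in> {1..n-1}" by auto
    with S have c: "sigma_mat n i \<in> carrier (GL (2 ^ n))" "sigma_mat n (i+1) \<in> carrier (GL (2 ^ n))"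
      by blast+
    have "sigma_mat n i \<otimes>\<^bsub>GL (2 ^ n)\<^esub> sigma_mat n (i+1) \<otimes>\<^bsub>GL (2 ^ n)\<^esub> sigma_mat n i =
        sigma_mat n (i+1) \<otimes>\<^bsub>GL (2 ^ n)\<^esub> sigma_mat n i \<otimes>\<^bsub>GL (2 ^ n)\<^esub> sigma_mat n (i+1)"
      unfolding mult_GL by (rule sigma_mat_braid[OF braid(1)])
    with c show ?thesis using braid(2,3) by (simp add: pos_word_def m_assoc)
  qed
qed

lemma braid_rep_hom: "braid_rep n \<in> hom (braid_group n) (GL (2 ^ n))"
  unfolding braid_rep_def braid_group_def
  by (rule group.pres_lift_hom[OF group_GL]) (auto intro: sigma_mat_GL sigma_mat_rels simp del: One_nat_def)

lemma braid_rep_sigma: "i \<in> {1..n-1} \<Longrightarrow> braid_rep n (sigma n i) = sigma_mat n i"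
  unfolding braid_rep_def sigma_def
  by (rule group.pres_lift_gen[OF group_GL]) (auto intro: sigma_mat_GL sigma_mat_rels simp del: One_nat_def)


section \<open>Exact sequences\<close>

text \<open>Exactness of \<open>1 \<rightarrow> A \<rightarrow> B \<rightarrow> C \<rightarrow> 1\<close>, with maps \<open>f\<close> and \<open>g\<close>. The library predicate for exact
  sequences requires all groups to have the same element type.\<close>

definition short_exact_groups ::
    "('a, 'm) monoid_scheme \<Rightarrow> ('b, 'n) monoid_scheme \<Rightarrow> ('c, 'k) monoid_scheme \<Rightarrow>
     ('a \<Rightarrow> 'b) \<Rightarrow> ('b \<Rightarrow> 'c) \<Rightarrow> bool" where
  "short_exact_groups A B C f g \<longleftrightarrow>
     group A \<and> group B \<and> group C \<and>
     f \<in> mon A B \<and> g \<in> epi B C \<and> f ` carrier A = kernel B C g"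

end

theory Submission
  imports Defs
begin

text \<open>There are pairwise anticommuting involutions \<open>c\<^sub>1, \<dots>, c\<^sub>n\<close> on the representation space such that
  \<open>\<sigma>\<^sub>i\<^sup>2 = c\<^sub>i c\<^sub>i\<^sub>+\<^sub>1\<close> and conjugation by \<open>\<sigma>\<^sub>i\<close> maps \<open>c\<^sub>i\<close> to \<open>-c\<^sub>i\<^sub>+\<^sub>1\<close>, maps \<open>c\<^sub>i\<^sub>+\<^sub>1\<close> to \<open>c\<^sub>i\<close>, and fixes
  the others. The image of the braid group thus permutes the pairs \<open>\<plusminus>c\<^sub>k\<close>, which is the map onto the
  symmetric group. The elements \<open>e\<^sub>i = \<sigma>\<^sub>i\<^sup>2\<close> satisfy the relations of \<open>E\<close>, and they generate a normal
  subgroup \<open>N\<close> acting trivially. Modulo \<open>N\<close>, an element of the group generated by \<open>\<sigma>\<^sub>1, \<dots>, \<sigma>\<^sub>k\<close> has the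
  form \<open>h \<sigma>\<^sub>k \<sigma>\<^sub>k\<^sub>-\<^sub>1 \<dots> \<sigma>\<^sub>j\<close> with \<open>h\<close> in the group generated by \<open>\<sigma>\<^sub>1, \<dots>, \<sigma>\<^sub>k\<^sub>-\<^sub>1\<close>; if it acts trivially, its
  effect on \<open>c\<^sub>k\<^sub>+\<^sub>1\<close> forces the descending product to be empty, so by induction the kernel is \<open>N\<close>. In
  the same way, every element of \<open>E\<close> has the form \<open>h\<close> or \<open>h x\<^sub>k\<close> with \<open>h\<close> in the subgroup generated by
  \<open>-1, x\<^sub>1, \<dots>, x\<^sub>k\<^sub>-\<^sub>1\<close>, and commutation with \<open>c\<^sub>k\<^sub>+\<^sub>1\<close> shows that \<open>E\<close> maps injectively onto \<open>N\<close>.\<close>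

section \<open>Presented groups and generated subgroups\<close>

lemma (in group) word_eval_image:
  assumes f: "f \<in> S \<rightarrow> carrier G"
  shows "word_eval G f ` words S = generate G (f ` S)"
proof
  have "word_eval G f u \<in> generate G (f ` S)" if "u \<in> words S" for u
    using that
  proof (induction u)
    case (Cons x u)
    obtain a b where "x = (a, b)" by force
    with Cons show ?case by (auto intro: generate.intros)
  qed (simp add: generate.one)
  then show "word_eval G f ` words S \<subseteq> generate G (f ` S)" by blast
next
  have "\<exists>u\<in>words S. x = word_eval G f u" if "x \<in> generate G (f ` S)" for x
    using that
  proof induction
    case one
    show ?case by (rule bexI[of _ "[]"]) auto
  next
    case (incl h)
    then obtain a where "a \<in> S" "h = f a" by blast
    then show ?case using f by (intro bexI[of _ "[(a, True)]"]) (auto simp: Pi_iff)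
  next
    case (inv h)
    then obtain a where "a \<in> S" "h = f a" by blast
    then show ?case using f by (intro bexI[of _ "[(a, False)]"]) (auto simp: Pi_iff)
  next
    case (eng x y)
    then obtain u v where "u \<in> words S" "x = word_eval G f u" "v \<in> words S" "y = word_eval G f v"
      by blast
    then show ?case by (intro bexI[of _ "u @ v"]) (auto simp: word_eval_append[OF f])
  qed
  then show "generate G (f ` S) \<subseteq> word_eval G f ` words S" by blast
qed

text \<open>This turns both the image of the braid group and the range of the map out of
  \<open>E_group m (-1)\<close> into generated subgroups, where induction over
  \<open>generate\<close> is available.\<close>

lemma (in group) pres_lift_image:
  assumes f: "f \<in> S \<rightarrow> carrier G"
    and rels: "\<And>r s. (r, s) \<in> rels \<Longrightarrow> word_eval G f r = word_eval G f s"
  shows "pres_lift G f ` carrier (presented_group S rels) = generate G (f ` S)"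
proof -
  have "carrier (presented_group S rels) = (\<lambda>u. pres_rel S rels `` {u}) ` words S"
    by (auto simp: presented_group_def quotient_def)
  then show ?thesis
    by (simp add: image_image pres_lift_class[OF assms] word_eval_image[OF f] cong: image_cong)
qed

lemma pres_gen_closed: "pres_gen S rels \<in> S \<rightarrow> carrier (presented_group S rels)"
  by (simp add: pres_gen_def presented_class_closed)

text \<open>The class of a concatenation is the product of the classes, and the class of a formal
  inverse letter is the inverse of the generator. Hence a presented group satisfies its own
  relations and is generated by the classes of its generators.\<close>

lemma word_eval_pres_gen:
  assumes "u \<in> words S"
  shows "word_eval (presented_group S rels) (pres_gen S rels) u = pres_rel S rels `` {u}"
  using assms
proof (induction u)
  case Nil
  show ?case by (simp add: presented_one)
next
  case (Cons x u)
  interpret group "presented_group S rels" by (rule group_presented)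
  obtain a b where x: "x = (a, b)" by force
  with Cons.prems have a: "a \<in> S" and u: "u \<in> words S" by auto
  have "pres_eq S rels ([] @ [(a, False), (a, \<not> False)] @ []) ([] @ [])"
    using a by (intro pres_eq.cancel) auto
  then have "pres_rel S rels `` {[(a, False), (a, True)]} = pres_rel S rels `` {[]}"
    by (intro equiv_class_eq[OF equiv_pres_rel]) (simp add: pres_rel_def)
  then have "pres_rel S rels `` {[(a, False)]} \<otimes>\<^bsub>presented_group S rels\<^esub> pres_gen S rels a
      = \<one>\<^bsub>presented_group S rels\<^esub>"
    using a by (simp add: pres_gen_def presented_mult_class presented_one)
  then have "inv\<^bsub>presented_group S rels\<^esub> pres_gen S rels a = pres_rel S rels `` {[(a, False)]}"
    using a pres_gen_closed[of S rels] by (intro inv_equality) (auto intro: presented_class_closed)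
  then show ?case
    using x a u Cons by (cases b) (auto simp: pres_gen_def presented_mult_class)
qed

lemma presented_rel:
  assumes "(r, s) \<in> rels" "r \<in> words S" "s \<in> words S"
  shows "word_eval (presented_group S rels) (pres_gen S rels) r =
         word_eval (presented_group S rels) (pres_gen S rels) s"
proof -
  have "pres_eq S rels ([] @ r @ []) ([] @ s @ [])"
    using assms by (intro pres_eq.rel) auto
  then show ?thesis
    using assms by (simp add: word_eval_pres_gen)
      (intro equiv_class_eq[OF equiv_pres_rel], simp add: pres_rel_def)
qed

lemma carrier_presented_generate:
  "carrier (presented_group S rels) = generate (presented_group S rels) (pres_gen S rels ` S)"
proof -
  interpret group "presented_group S rels" by (rule group_presented)
  have "carrier (presented_group S rels) = (\<lambda>u. pres_rel S rels `` {u}) ` words S"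
    by (auto simp: presented_group_def quotient_def)
  then show ?thesis
    unfolding word_eval_image[OF pres_gen_closed, symmetric]
    by (simp add: word_eval_pres_gen cong: image_cong)
qed

text \<open>The condition on inverses lets us avoid checking closure under right multiplication by
  inverses of generators.\<close>

lemma (in group) generate_subset_cosets:
  assumes K: "subgroup K G" and T: "T \<subseteq> carrier G" "\<one> \<in> T" and Y: "Y \<subseteq> carrier G"
    and inv: "\<And>y. y \<in> Y \<Longrightarrow> inv y \<in> Y \<or> (\<exists>y'\<in>Y. inv y = y \<otimes> y')"
    and step: "\<And>t y. t \<in> T \<Longrightarrow> y \<in> Y \<Longrightarrow> \<exists>k\<in>K. \<exists>t'\<in>T. t \<otimes> y = k \<otimes> t'"
    and x: "x \<in> generate G Y"
  shows "\<exists>k\<in>K. \<exists>t\<in>T. x = k \<otimes> t"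
proof -
  define U where "U = {k \<otimes> t | k t. k \<in> K \<and> t \<in> T}"
  have Tc: "t \<in> carrier G" if "t \<in> T" for t using that T by blast
  have Yc: "y \<in> carrier G" if "y \<in> Y" for y using that Y by blast
  have Kc: "k \<in> carrier G" if "k \<in> K" for k using that subgroup.mem_carrier[OF K] by blast
  have U: "u \<in> carrier G" if "u \<in> U" for u using that Kc T by (auto simp: U_def)
  have UY: "u \<otimes> y \<in> U" if u: "u \<in> U" and y: "y \<in> Y" for u y
  proof -
    from u obtain k t where kt: "u = k \<otimes> t" "k \<in> K" "t \<in> T" by (auto simp: U_def)
    from step[OF kt(3) y] obtain k' t' where k': "k' \<in> K" "t' \<in> T" "t \<otimes> y = k' \<otimes> t'" by blast
    have "u \<otimes> y = k \<otimes> (t \<otimes> y)" using kt y Tc Yc Kc by (simp add: m_assoc)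
    also have "\<dots> = (k \<otimes> k') \<otimes> t'" using kt k' Tc Kc by (simp add: m_assoc)
    finally show ?thesis using subgroup.m_closed[OF K] kt k' by (auto simp: U_def)
  qed
  \<comment> \<open>Stability of \<open>U\<close> under right multiplication passes through
    products; applied to \<open>\<one>\<close> in \<open>U\<close>, it places \<open>x\<close>
    itself in \<open>U\<close>.\<close>
  have "\<forall>u\<in>U. u \<otimes> x \<in> U" using x
  proof induction
    case one
    then show ?case using U by auto
  next
    case (incl h)
    then show ?case using UY by blast
  next
    case (inv h)
    show ?case
    proof
      fix u assume u: "u \<in> U"
      from assms(5)[OF inv] show "u \<otimes> inv h \<in> U"
      proof
        assume "inv h \<in> Y"
        then show ?thesis using UY u by blast
      next
        assume "\<exists>y'\<in>Y. inv h = h \<otimes> y'"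
        then obtain y' where y': "y' \<in> Y" "inv h = h \<otimes> y'" by blast
        have "u \<otimes> inv h = (u \<otimes> h) \<otimes> y'" using y' u inv U Yc by (simp add: m_assoc)
        then show ?thesis using UY u inv y' by simp
      qed
    qed
  next
    case (eng h1 h2)
    have "h1 \<in> carrier G" "h2 \<in> carrier G" using eng generate_in_carrier[OF Y] by blast+
    then show ?case using eng U by (simp add: m_assoc[symmetric])
  qed
  moreover have "\<one> \<in> U" using subgroup.one_closed[OF K] T unfolding U_def by force
  moreover have "x \<in> carrier G" using x generate_in_carrier[OF Y] by blast
  ultimately have "x \<in> U" by force
  then show ?thesis by (auto simp: U_def)
qed

section \<open>Majorana matrices\<close>

text \<open>The negative of the Pauli matrix Z; \<open>flip_mat\<close> is the Pauli matrix
  X.\<close>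

definition sign_mat :: "complex mat" where
  "sign_mat = mat_of_rows_list 2 [[-1, 0], [0, 1]]"

definition flip_mat :: "complex mat" where
  "flip_mat = mat_of_rows_list 2 [[0, 1], [1, 0]]"

text \<open>The Jordan--Wigner form of pairwise anticommuting involutions. The signs in \<open>sign_mat\<close> are chosen
  such that \<open>\<sigma>\<^sub>i\<^sup>2\<close> is the product of the \<open>i\<close>-th and the \<open>(i+1)\<close>-st of them.\<close>

definition majorana :: "nat \<Rightarrow> nat \<Rightarrow> complex mat" where
  "majorana n k = kron (kron (kron_pow sign_mat (k - 1)) flip_mat) (kron_pow (1\<^sub>m 2) (n - k))"

lemma sign_flip_carrier: "sign_mat \<in> carrier_mat 2 2" "flip_mat \<in> carrier_mat 2 2"
  by (rule carrier_matI; simp add: sign_mat_def flip_mat_def mat_of_rows_list_def)+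

lemma sign_flip_mult:
  "sign_mat * sign_mat = 1\<^sub>m 2" "flip_mat * flip_mat = 1\<^sub>m 2"
  "flip_mat * sign_mat = (-1) \<cdot>\<^sub>m (sign_mat * flip_mat)"
  by (rule eq_matI; auto simp: sign_mat_def flip_mat_def mat_of_rows_list_def scalar_prod_def
      less_Suc_eq numeral_2_eq_2)+

lemma kron_pow_carrier: "A \<in> carrier_mat d d \<Longrightarrow> kron_pow A k \<in> carrier_mat (d ^ k) (d ^ k)"
  by (induction k) (auto simp: mult.commute)

lemma kron_pow_add: "kron_pow A (a + b) = kron (kron_pow A a) (kron_pow A b)"
  by (induction b) (simp_all add: kron_assoc del: One_nat_def)

lemma kron_pow_1: "kron_pow A 1 = A"
  by (simp add: kron_one_left[unfolded One_nat_def])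

lemma kron_mult3:
  assumes "A \<in> carrier_mat a a" "A' \<in> carrier_mat a a" "B \<in> carrier_mat b b" "B' \<in> carrier_mat b b"
    "C \<in> carrier_mat c c" "C' \<in> carrier_mat c c"
  shows "kron (kron A B) C * kron (kron A' B') C' = kron (kron (A * A') (B * B')) (C * C')"
  using kron_mult[OF kron_carrier[OF assms(1,3)] kron_carrier[OF assms(2,4)] assms(5,6)]
    kron_mult[OF assms(1-4)] by simp

section \<open>Two-site computations with explicit four-by-four matrices\<close>

lemma mat_4_eqI:
  assumes "A \<in> carrier_mat 4 4" "B \<in> carrier_mat 4 4"
    "\<And>i j. i \<in> {0, 1, 2, 3} \<Longrightarrow> j \<in> {0, 1, 2, 3} \<Longrightarrow> A $$ (i, j) = B $$ (i, j)"
  shows "A = B"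
proof (rule eq_matI)
  have less_4: "i < (4 :: nat) \<Longrightarrow> i \<in> {0, 1, 2, 3}" for i
    by (simp only: insert_iff empty_iff) presburger
  fix i j assume "i < dim_row B" "j < dim_col B"
  then have "i < 4" "j < 4" using assms(2) by auto
  then show "A $$ (i, j) = B $$ (i, j)" by (intro assms(3) less_4)
qed (use assms(1,2) in auto)

lemma mat_of_rows_list_4:
  assumes "length xs = 4"
  shows "mat_of_rows_list 4 xs \<in> carrier_mat 4 4"
    "i \<in> {0, 1, 2, 3} \<Longrightarrow> j \<in> {0, 1, 2, 3} \<Longrightarrow> mat_of_rows_list 4 xs $$ (i, j) = xs ! i ! j"
proof -
  have less_4: "i < 4" if "i \<in> {0, 1, 2, 3}" for i :: nat
    using that by (elim insertE emptyE) simp_all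
  show "mat_of_rows_list 4 xs \<in> carrier_mat 4 4"
    using assms by (intro carrier_matI) (simp_all add: mat_of_rows_list_def)
  show "mat_of_rows_list 4 xs $$ (i, j) = xs ! i ! j"
    if "i \<in> {0, 1, 2, 3}" "j \<in> {0, 1, 2, 3}"
    using assms less_4[OF that(1)] less_4[OF that(2)] by (simp add: mat_of_rows_list_def)
qed

lemma mat_4_eq_listI:
  assumes "A \<in> carrier_mat 4 4" "length xs = 4"
    "\<And>i j. i \<in> {0, 1, 2, 3} \<Longrightarrow> j \<in> {0, 1, 2, 3} \<Longrightarrow> A $$ (i, j) = xs ! i ! j"
  shows "A = mat_of_rows_list 4 xs"
proof (rule mat_4_eqI[OF assms(1) mat_of_rows_list_4(1)[OF assms(2)]])
  fix i j :: nat assume ij: "i \<in> {0, 1, 2, 3}" "j \<in> {0, 1, 2, 3}"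
  show "A $$ (i, j) = mat_of_rows_list 4 xs $$ (i, j)"
    unfolding mat_of_rows_list_4(2)[OF assms(2) ij] by (rule assms(3)[OF ij])
qed

text \<open>On the two tensor factors that \<open>R_mat\<close> touches,
  \<open>kron flip_mat (1\<^sub>m 2)\<close>, \<open>kron sign_mat flip_mat\<close> and
  \<open>kron sign_mat sign_mat\<close> are the local parts of the \<open>i\<close>-th, the next and
  all later Majorana operators. The identities are finite and are checked entry by entry.\<close>

lemma R_mat_majorana:
  "R_mat * kron flip_mat (1\<^sub>m 2) = (-1) \<cdot>\<^sub>m (kron sign_mat flip_mat * R_mat)"
  "R_mat * kron sign_mat flip_mat = kron flip_mat (1\<^sub>m 2) * R_mat"
  "R_mat * kron sign_mat sign_mat = kron sign_mat sign_mat * R_mat"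
  "R_mat * R_mat = kron flip_mat (1\<^sub>m 2) * kron sign_mat flip_mat"
proof -
  let ?c = "complex_of_real (1 / sqrt 2)"
  \<comment> \<open>The matrix \<open>r\<close> has integer entries, which keeps square roots out of
    the entrywise computations.\<close>
  define r where "r = (mat_of_rows_list 4 [[1,0,0,1],[0,1,-1,0],[0,1,1,0],[-1,0,0,1]] :: complex mat)"
  have R: "R_mat = ?c \<cdot>\<^sub>m r" by (simp add: R_mat_def r_def)
  have r: "r \<in> carrier_mat 4 4" by (rule carrier_matI) (simp_all add: r_def mat_of_rows_list_def)
  note s = sign_flip_carrier
  have I: "1\<^sub>m 2 \<in> carrier_mat 2 (2 :: nat)" by simp
  define p where "p = kron flip_mat (1\<^sub>m 2)"
  define q where "q = kron sign_mat flip_mat"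
  define t where "t = kron sign_mat sign_mat"
  have car: "p \<in> carrier_mat 4 4" "q \<in> carrier_mat 4 4" "t \<in> carrier_mat 4 4"
    unfolding p_def q_def t_def
    using kron_carrier[OF s(2) I] kron_carrier[OF s] kron_carrier[OF s(1,1)] by simp_all
  have ent: "sign_mat $$ (0, 0) = -1" "sign_mat $$ (0, 1) = 0" "sign_mat $$ (1, 0) = 0"
    "sign_mat $$ (1, 1) = 1" "flip_mat $$ (0, 0) = 0" "flip_mat $$ (0, 1) = 1"
    "flip_mat $$ (1, 0) = 1" "flip_mat $$ (1, 1) = 0"
    by (simp_all add: sign_mat_def flip_mat_def mat_of_rows_list_def)
  have dim: "dim_row sign_mat = 2" "dim_col sign_mat = 2" "dim_row flip_mat = 2" "dim_col flip_mat = 2"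
    using s by auto
  have div_mod: "3 div 2 = (1::nat)" "3 mod 2 = (1::nat)" "2 div 2 = (1::nat)" "2 mod 2 = (0::nat)"
    by simp_all
  note ent = ent ent[unfolded One_nat_def] dim div_mod
  have p: "p = mat_of_rows_list 4 [[0,1,0,0],[1,0,0,0],[0,0,0,1],[0,0,1,0]]"
    by (rule mat_4_eq_listI[OF car(1)], simp)
       (elim insertE emptyE; simp add: p_def kron_index ent)
  have q: "q = mat_of_rows_list 4 [[0,0,-1,0],[0,0,0,1],[-1,0,0,0],[0,1,0,0]]"
    by (rule mat_4_eq_listI[OF car(2)], simp)
       (elim insertE emptyE; simp add: q_def kron_index ent)
  have t: "t = mat_of_rows_list 4 [[1,0,0,0],[0,-1,0,0],[0,0,-1,0],[0,0,0,1]]"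
    by (rule mat_4_eq_listI[OF car(3)], simp)
       (elim insertE emptyE; simp add: t_def kron_index ent)
  have less_4: "i \<in> {0, 1, 2, 3} \<Longrightarrow> i < 4" for i :: nat by auto
  have mult: "(A * B) $$ (i, j) = A $$ (i, 0) * B $$ (0, j) + A $$ (i, 1) * B $$ (1, j) +
      A $$ (i, 2) * B $$ (2, j) + A $$ (i, 3) * B $$ (3, j)"
    if "A \<in> carrier_mat 4 4" "B \<in> carrier_mat 4 4" "i \<in> {0, 1, 2, 3}" "j \<in> {0, 1, 2, 3}"
    for A B :: "complex mat" and i j
    using that(1,2) less_4[OF that(3)] less_4[OF that(4)]
    by (simp add: scalar_prod_def eval_nat_numeral)
  have smult: "(a \<cdot>\<^sub>m A) $$ (i, j) = a * A $$ (i, j)"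
    if "A \<in> carrier_mat 4 4" "i \<in> {0, 1, 2, 3}" "j \<in> {0, 1, 2, 3}"
    for a :: complex and A i j
    using that(1) less_4[OF that(2)] less_4[OF that(3)] by simp
  have r_ent: "r $$ (i, j) =
      [[1,0,0,1],[0,1,-1,0],[0,1,1,0],[-1,0,0,1]] ! i ! j" (is "_ = ?r ! i ! j")
    and p_ent: "p $$ (i, j) = [[0,1,0,0],[1,0,0,0],[0,0,0,1],[0,0,1,0]] ! i ! j" (is "_ = ?p ! i ! j")
    and q_ent: "q $$ (i, j) = [[0,0,-1,0],[0,0,0,1],[-1,0,0,0],[0,1,0,0]] ! i ! j" (is "_ = ?q ! i ! j")
    and t_ent: "t $$ (i, j) = [[1,0,0,0],[0,-1,0,0],[0,0,-1,0],[0,0,0,1]] ! i ! j" (is "_ = ?t ! i ! j")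
    if "i \<in> {0, 1, 2, 3}" "j \<in> {0, 1, 2, 3}" for i j
    using that mat_of_rows_list_4(2)[OF _ that, of ?r] mat_of_rows_list_4(2)[OF _ that, of ?p] mat_of_rows_list_4(2)[OF _ that, of ?q]
      mat_of_rows_list_4(2)[OF _ that, of ?t]
    by (simp_all add: r_def p q t)
  note index = mult[OF r car(1)] mult[OF r car(2)] mult[OF r car(3)] mult[OF car(1) r]
    mult[OF car(2) r] mult[OF car(3) r] mult[OF r r] mult[OF car(1,2)]
    r_ent p_ent q_ent t_ent smult[OF mult_carrier_mat[OF car(2) r]]
    smult[OF mult_carrier_mat[OF car(1,2)]]
  have rp: "r * p = (-1) \<cdot>\<^sub>m (q * r)"
    by (rule mat_4_eqI, use r car in simp, use r car in simp)
       (elim insertE emptyE; simp add: index)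
  have rq: "r * q = p * r"
    by (rule mat_4_eqI, use r car in simp, use r car in simp)
       (elim insertE emptyE; simp add: index)
  have rt: "r * t = t * r"
    by (rule mat_4_eqI, use r car in simp, use r car in simp)
       (elim insertE emptyE; simp add: index)
  have rr: "r * r = 2 \<cdot>\<^sub>m (p * q)"
    by (rule mat_4_eqI, use r car in simp, use r car in simp)
       (elim insertE emptyE; simp add: index)
  \<comment> \<open>The factor \<open>1 / sqrt 2\<close> occurs twice in
    \<open>R_mat * R_mat\<close> and cancels the 2 in \<open>rr\<close>.\<close>
  have "?c * ?c = 1 / 2" by (simp flip: of_real_mult)
  then have c: "?c * (?c * 2) = 1" by (simp only: mult.assoc[symmetric]) simp
  have one: "1 \<cdot>\<^sub>m (p * q) = p * q" by (rule eq_matI) auto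
  note sm = mult_smult_assoc_mat[of _ 4 4 _ 4] mult_smult_distrib[of _ 4 4 _ 4] smult_smult_mat
  show "R_mat * kron flip_mat (1\<^sub>m 2) = (-1) \<cdot>\<^sub>m (kron sign_mat flip_mat * R_mat)"
    unfolding R p_def[symmetric] q_def[symmetric] using r car
    by (simp add: sm rp mult.commute del: of_real_divide)
  show "R_mat * kron sign_mat flip_mat = kron flip_mat (1\<^sub>m 2) * R_mat"
    unfolding R p_def[symmetric] q_def[symmetric] using r car
    by (simp add: sm rq del: of_real_divide)
  show "R_mat * kron sign_mat sign_mat = kron sign_mat sign_mat * R_mat"
    unfolding R t_def[symmetric] using r car
    by (simp add: sm rt del: of_real_divide)
  show "R_mat * R_mat = kron flip_mat (1\<^sub>m 2) * kron sign_mat flip_mat"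
    unfolding R p_def[symmetric] q_def[symmetric] using r car
    by (simp add: sm rr c one del: of_real_divide)
qed

section \<open>Majorana operators on the whole tensor product\<close>

lemma majorana_eq:
  "majorana n k = kron (kron (kron_pow sign_mat (k - 1)) flip_mat) (1\<^sub>m (2 ^ (n - k)))"
  by (simp add: majorana_def kron_pow_one)

text \<open>A late Majorana operator starts with a long string of \<open>sign_mat\<close>. Cutting
  it after \<open>j\<close> and \<open>j + d\<close> factors isolates a block to compare with
  another operator: \<open>d = 1\<close> serves anticommutation, \<open>d = 2\<close> the two sites
  of \<open>R_mat\<close>.\<close>

lemma majorana_block:
  assumes "j + d \<le> k - 1" "1 \<le> k" "k \<le> n"
  obtains D where "D \<in> carrier_mat (2 ^ (n - j - d)) (2 ^ (n - j - d))"
    "majorana n k = kron (kron (kron_pow sign_mat j) (kron_pow sign_mat d)) D"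
proof
  let ?D = "kron (kron (kron_pow sign_mat (k - 1 - j - d)) flip_mat) (1\<^sub>m (2 ^ (n - k)))"
  have k: "k - 1 = j + d + (k - 1 - j - d)" using assms by simp
  show "majorana n k = kron (kron (kron_pow sign_mat j) (kron_pow sign_mat d)) ?D"
    unfolding majorana_eq by (subst k) (simp only: kron_pow_add kron_assoc)
  have "n - j - d = k - 1 - j - d + (1 + (n - k))" using assms by simp
  then have "2 ^ (n - j - d) = 2 ^ (k - 1 - j - d) * 2 * (2 ^ (n - k) :: nat)"
    by (simp only: power_add power_one_right mult.assoc)
  then show "?D \<in> carrier_mat (2 ^ (n - j - d)) (2 ^ (n - j - d))"
    by (metis kron_carrier kron_pow_carrier sign_flip_carrier one_carrier_mat)
qed

lemma majorana_carrier:
  assumes "1 \<le> k" "k \<le> n"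
  shows "majorana n k \<in> carrier_mat (2 ^ n) (2 ^ n)"
proof -
  obtain D where "D \<in> carrier_mat (2 ^ n) (2 ^ n)" "majorana n k = D"
    using majorana_block[of 0 0 k n] assms by (auto simp del: One_nat_def)
  then show ?thesis by simp
qed

lemma sign_mat_pow_square: "kron_pow sign_mat k * kron_pow sign_mat k = 1\<^sub>m (2 ^ k)"
proof (induction k)
  case (Suc k)
  note c = kron_pow_carrier[OF sign_flip_carrier(1), of k] sign_flip_carrier(1)
  show ?case
    by (simp add: kron_mult[OF c(1,1,2,2)] Suc sign_flip_mult kron_one mult.commute)
qed simp

lemma majorana_square:
  assumes "1 \<le> k" "k \<le> n"
  shows "majorana n k * majorana n k = 1\<^sub>m (2 ^ n)"
proof -
  have "n = k - 1 + (1 + (n - k))" using assms by simp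
  then have n: "2 ^ n = 2 ^ (k - 1) * 2 * (2 ^ (n - k) :: nat)"
    by (metis power_add power_one_right mult.assoc)
  note c = kron_pow_carrier[OF sign_flip_carrier(1), of "k - 1"] sign_flip_carrier(2)
    one_carrier_mat[of "2 ^ (n - k)"]
  show ?thesis unfolding majorana_eq kron_mult3[OF c(1,1,2,2,3,3)]
    by (simp only: sign_mat_pow_square sign_flip_mult kron_one n left_mult_one_mat[OF c(3)])
qed

text \<open>Site by site the two operators commute, except at site \<open>j\<close>, where
  \<open>flip_mat\<close> meets \<open>sign_mat\<close>; this single site yields the sign.\<close>

lemma majorana_anticommute:
  assumes "1 \<le> j" "j < k" "k \<le> n"
  shows "majorana n j * majorana n k = (-1) \<cdot>\<^sub>m (majorana n k * majorana n j)"
proof -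
  have "j - 1 + 1 \<le> k - 1" "1 \<le> k" using assms by auto
  then obtain D where D: "D \<in> carrier_mat (2 ^ (n - j)) (2 ^ (n - j))"
    "majorana n k = kron (kron (kron_pow sign_mat (j - 1)) sign_mat) D"
    using majorana_block[of "j - 1" 1 k n] assms
    by (auto simp: kron_pow_1 simp del: One_nat_def)
  note c = kron_pow_carrier[OF sign_flip_carrier(1), of "j - 1"] sign_flip_carrier
    one_carrier_mat[of "2 ^ (n - j)"]
  show ?thesis
    unfolding D(2) majorana_eq[of n j] kron_mult3[OF c(1,1,3,2,4) D(1)]
      kron_mult3[OF c(1,1,2,3) D(1) c(4)] sign_flip_mult
    using D(1) by (simp add: kron_smult_left kron_smult_right)
qed

text \<open>Away from the two sites of \<open>R_mat\<close> the braid generator is the identity, so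
  the claims reduce to \<open>R_mat_majorana\<close>, or to commutation of operators on disjoint
  sites when \<open>k < i\<close>. In the third claim the strings of \<open>sign_mat\<close> to the
  left square to the identity.\<close>

lemma sigma_majorana:
  assumes "1 \<le> i" "i < n"
  shows "sigma_mat n i * majorana n i = (-1) \<cdot>\<^sub>m (majorana n (Suc i) * sigma_mat n i)"
    "sigma_mat n i * majorana n (Suc i) = majorana n i * sigma_mat n i"
    "sigma_mat n i * sigma_mat n i = majorana n i * majorana n (Suc i)"
    "1 \<le> k \<Longrightarrow> k \<le> n \<Longrightarrow> k \<noteq> i \<Longrightarrow> k \<noteq> Suc i \<Longrightarrow>
      sigma_mat n i * majorana n k = majorana n k * sigma_mat n i"
proof -
  define a b where "a = i - 1" and "b = n - i - 1"
  have e: "n - i = 1 + b" "n - Suc i = b" "Suc i - 1 = a + 1" "n - i - 1 = b"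
    using assms by (auto simp: a_def b_def)
  let ?P = "kron_pow sign_mat"
  let ?I = "\<lambda>k. 1\<^sub>m (2 ^ k) :: complex mat"
  have I: "?I (1 + x) = kron (1\<^sub>m 2) (?I x)" for x by (simp add: kron_one)
  have sigma: "sigma_mat n i = kron (kron (?I a) R_mat) (?I b)"
    by (simp only: sigma_mat_def kron_pow_one a_def e(4))
  have m0: "majorana n i = kron (kron (?P a) (kron flip_mat (1\<^sub>m 2))) (?I b)"
    unfolding majorana_eq e I a_def by (simp only: kron_assoc)
  have m1: "majorana n (Suc i) = kron (kron (?P a) (kron sign_mat flip_mat)) (?I b)"
    unfolding majorana_eq e kron_pow_add by (simp add: kron_assoc kron_pow_1 del: One_nat_def)
  have four: "kron A B \<in> carrier_mat 4 4" if "A \<in> carrier_mat 2 2" "B \<in> carrier_mat 2 2"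
    for A B :: "complex mat"
    using kron_carrier[OF that] by simp
  note c = one_carrier_mat[of "2 ^ a"] kron_pow_carrier[OF sign_flip_carrier(1), of a]
    R_mat_carrier four[OF sign_flip_carrier(2) one_carrier_mat] four[OF sign_flip_carrier]
    one_carrier_mat[of "2 ^ b"] four[OF sign_flip_carrier(1,1)]
  have one: "?I a * ?P a = ?P a" "?P a * ?I a = ?P a"
    using left_mult_one_mat[OF c(2)] right_mult_one_mat[OF c(2)] by simp_all
  show "sigma_mat n i * majorana n i = (-1) \<cdot>\<^sub>m (majorana n (Suc i) * sigma_mat n i)"
    unfolding sigma m0 m1 kron_mult3[OF c(1,2,3,4,6,6)] kron_mult3[OF c(2,1,5,3,6,6)]
    by (simp only: one R_mat_majorana kron_smult_left kron_smult_right)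
  show "sigma_mat n i * majorana n (Suc i) = majorana n i * sigma_mat n i"
    unfolding sigma m0 m1 kron_mult3[OF c(1,2,3,5,6,6)] kron_mult3[OF c(2,1,4,3,6,6)]
    by (simp only: one R_mat_majorana)
  show "sigma_mat n i * sigma_mat n i = majorana n i * majorana n (Suc i)"
    unfolding sigma m0 m1 kron_mult3[OF c(1,1,3,3,6,6)] kron_mult3[OF c(2,2,4,5,6,6)]
    by (simp add: sign_mat_pow_square R_mat_majorana)
  show "sigma_mat n i * majorana n k = majorana n k * sigma_mat n i"
    if k: "1 \<le> k" "k \<le> n" "k \<noteq> i" "k \<noteq> Suc i"
  proof (cases "k < i")
    case True
    \<comment> \<open>This operator lives on the \<open>i - 1\<close> sites to the left of
      \<open>R_mat\<close>.\<close>
    let ?D = "majorana a k"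
    have "k \<le> a" using True by (simp add: a_def)
    then have D: "?D \<in> carrier_mat (2 ^ a) (2 ^ a)" using k majorana_carrier by simp
    have "n - k = (a - k) + (2 + b)" using \<open>k \<le> a\<close> assms by (simp add: a_def b_def)
    then have "?I (n - k) = kron (?I (a - k)) (kron (1\<^sub>m 4) (?I b))"
      by (simp add: kron_one power_add mult.left_commute)
    then have m: "majorana n k = kron (kron ?D (1\<^sub>m 4)) (?I b)"
      unfolding majorana_eq by (simp only: kron_assoc)
    show ?thesis
      unfolding sigma m kron_mult3[OF c(1) D c(3) one_carrier_mat c(6,6)]
        kron_mult3[OF D c(1) one_carrier_mat c(3,6,6)]
      using D R_mat_carrier by simp
  next
    case False
    \<comment> \<open>For \<open>k > Suc i\<close> both sites of \<open>R_mat\<close> lie inside the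
      string of \<open>sign_mat\<close>, and \<open>R_mat\<close> commutes with
      \<open>kron sign_mat sign_mat\<close>.\<close>
    have "kron_pow sign_mat 2 = kron sign_mat sign_mat"
      by (simp add: numeral_2_eq_2 del: One_nat_def)
    moreover have "n - a - 2 = b" "a + 2 \<le> k - 1" using assms k False by (auto simp: a_def b_def)
    ultimately obtain D where D: "D \<in> carrier_mat (2 ^ b) (2 ^ b)"
      "majorana n k = kron (kron (?P a) (kron sign_mat sign_mat)) D"
      using majorana_block[of a 2 k n] k by auto
    show ?thesis
      unfolding sigma D(2) kron_mult3[OF c(1,2,3,7,6) D(1)] kron_mult3[OF c(2,1,7,3) D(1) c(6)]
      using D(1) by (simp add: one R_mat_majorana)
  qed
qed

section \<open>Majorana braid operators in a group\<close>

text \<open>Here \<open>z\<close> plays the role of \<open>-1\<close>, \<open>c k\<close> of the Majorana operators, and \<open>s i\<close> of the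
  braid generators.\<close>

locale majorana_braiding = group G for G (structure) +
  fixes z :: 'a and c s :: "nat \<Rightarrow> 'a" and m :: nat
  assumes z_closed: "z \<in> carrier G"
    and z_central: "x \<in> carrier G \<Longrightarrow> x \<otimes> z = z \<otimes> x"
    and z_neq: "z \<noteq> \<one>"
    and z_sq: "z \<otimes> z = \<one>"
    and c_closed: "k \<in> {1..Suc m} \<Longrightarrow> c k \<in> carrier G"
    and c_sq: "k \<in> {1..Suc m} \<Longrightarrow> c k \<otimes> c k = \<one>"
    and c_anti: "j \<in> {1..Suc m} \<Longrightarrow> k \<in> {1..Suc m} \<Longrightarrow> j \<noteq> k \<Longrightarrow>
      c j \<otimes> c k = z \<otimes> (c k \<otimes> c j)"
    and s_closed: "i \<in> {1..m} \<Longrightarrow> s i \<in> carrier G"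
    and s_sq: "i \<in> {1..m} \<Longrightarrow> s i \<otimes> s i = c i \<otimes> c (Suc i)"
    and s_c: "i \<in> {1..m} \<Longrightarrow> s i \<otimes> c i = z \<otimes> (c (Suc i) \<otimes> s i)"
    and s_c_Suc: "i \<in> {1..m} \<Longrightarrow> s i \<otimes> c (Suc i) = c i \<otimes> s i"
    and s_c_other: "i \<in> {1..m} \<Longrightarrow> k \<in> {1..Suc m} \<Longrightarrow> k \<noteq> i \<Longrightarrow> k \<noteq> Suc i \<Longrightarrow>
      s i \<otimes> c k = c k \<otimes> s i"
    and s_far: "i \<in> {1..m} \<Longrightarrow> j \<in> {1..m} \<Longrightarrow> i + 2 \<le> j \<Longrightarrow> s i \<otimes> s j = s j \<otimes> s i"
    and s_braid: "i \<in> {1..m} \<Longrightarrow> Suc i \<in> {1..m} \<Longrightarrow>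
      s i \<otimes> s (Suc i) \<otimes> s i = s (Suc i) \<otimes> s i \<otimes> s (Suc i)"
begin

section \<open>Products of neighbouring Majorana operators\<close>

definition e :: "nat \<Rightarrow> 'a" where
  "e i = c i \<otimes> c (Suc i)"

lemma e_closed: "i \<in> {1..m} \<Longrightarrow> e i \<in> carrier G"
  by (simp add: e_def c_closed)

lemma z_left_commute: "x \<in> carrier G \<Longrightarrow> y \<in> carrier G \<Longrightarrow> x \<otimes> (z \<otimes> y) = z \<otimes> (x \<otimes> y)"
  by (metis z_central z_closed m_assoc)

lemma z_left_cancel: "x \<in> carrier G \<Longrightarrow> z \<otimes> (z \<otimes> x) = x"
  by (metis z_sq z_closed m_assoc l_one)

text \<open>Moving \<open>c k\<close> past a factor of \<open>e i\<close> costs \<open>z\<close>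
  unless the indices agree. For \<open>k\<close> outside the pair the two signs cancel; inside the
  pair exactly one remains.\<close>

lemma e_c:
  assumes "i \<in> {1..m}" "k \<in> {1..Suc m}"
  shows "e i \<otimes> c k = (if k = i \<or> k = Suc i then z \<otimes> (c k \<otimes> e i) else c k \<otimes> e i)"
proof -
  have cl: "c i \<in> carrier G" "c (Suc i) \<in> carrier G" "c k \<in> carrier G" "z \<in> carrier G"
    using assms c_closed z_closed by auto
  have i: "i \<in> {1..Suc m}" "Suc i \<in> {1..Suc m}" using assms by auto
  consider "k = i" | "k = Suc i" | "k \<noteq> i" "k \<noteq> Suc i" by blast
  then show ?thesis
  proof cases
    case 1
    have "e i \<otimes> c k = c i \<otimes> (c (Suc i) \<otimes> c i)" using cl 1 by (simp add: e_def m_assoc)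
    also have "\<dots> = c i \<otimes> (z \<otimes> (c i \<otimes> c (Suc i)))" using c_anti[OF i(2,1)] by simp
    finally show ?thesis using cl 1 by (simp add: e_def z_left_commute)
  next
    case 2
    have "c k \<otimes> e i = c (Suc i) \<otimes> c i \<otimes> c (Suc i)" using cl 2 by (simp add: e_def m_assoc)
    also have "\<dots> = z \<otimes> (c i \<otimes> c (Suc i) \<otimes> c (Suc i))" using c_anti[OF i(2,1)] cl by (simp add: m_assoc)
    finally show ?thesis using cl 2 by (simp add: e_def z_left_cancel)
  next
    case 3
    have "e i \<otimes> c k = c i \<otimes> (c (Suc i) \<otimes> c k)" using cl by (simp add: e_def m_assoc)
    also have "\<dots> = z \<otimes> (c i \<otimes> c k \<otimes> c (Suc i))"
      using c_anti[OF i(2) assms(2)] 3 cl by (simp add: m_assoc z_left_commute)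
    also have "\<dots> = z \<otimes> (z \<otimes> (c k \<otimes> c i \<otimes> c (Suc i)))"
      using c_anti[OF i(1) assms(2)] 3 cl by (simp add: m_assoc)
    finally show ?thesis using cl 3 by (simp add: e_def z_left_cancel m_assoc)
  qed
qed

lemma e_sq: "i \<in> {1..m} \<Longrightarrow> e i \<otimes> e i = z"
proof -
  assume i: "i \<in> {1..m}"
  then have cl: "c i \<in> carrier G" "c (Suc i) \<in> carrier G" using c_closed by auto
  have "e i \<otimes> e i = e i \<otimes> c i \<otimes> c (Suc i)"
    using cl i e_closed by (simp add: e_def[of i] m_assoc)
  also have "\<dots> = z \<otimes> (c i \<otimes> (c i \<otimes> c (Suc i) \<otimes> c (Suc i)))"
    using e_c[of i i] i cl z_closed by (simp add: e_def m_assoc)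
  also have "c i \<otimes> c (Suc i) \<otimes> c (Suc i) = c i"
    using cl i c_sq[of "Suc i"] by (simp add: m_assoc)
  finally show ?thesis using c_sq[of i] i z_closed by simp
qed

lemma e_far:
  assumes "i \<in> {1..m}" "j \<in> {1..m}" "i + 2 \<le> j \<or> j + 2 \<le> i"
  shows "e i \<otimes> e j = e j \<otimes> e i"
proof -
  have cl: "c j \<in> carrier G" "c (Suc j) \<in> carrier G" "e i \<in> carrier G"
    using assms c_closed e_closed by auto
  have "e i \<otimes> e j = e i \<otimes> c j \<otimes> c (Suc j)" using cl by (simp add: e_def[of j] m_assoc)
  also have "e i \<otimes> c j = c j \<otimes> e i" using e_c[of i j] assms by auto
  also have "c j \<otimes> e i \<otimes> c (Suc j) = c j \<otimes> (e i \<otimes> c (Suc j))" using cl by (simp add: m_assoc)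
  also have "e i \<otimes> c (Suc j) = c (Suc j) \<otimes> e i" using e_c[of i "Suc j"] assms by auto
  finally show ?thesis using cl by (simp add: e_def[of j] m_assoc)
qed

text \<open>The two pairs share only the index \<open>Suc i\<close>, so among the factors of
  \<open>e i\<close> only \<open>c (Suc i)\<close> anticommutes with
  \<open>e (Suc i)\<close>.\<close>

lemma e_Suc:
  assumes "i \<in> {1..m}" "Suc i \<in> {1..m}"
  shows "e (Suc i) \<otimes> e i = z \<otimes> (e i \<otimes> e (Suc i))"
proof -
  let ?e = "e (Suc i)"
  have cl: "c i \<in> carrier G" "c (Suc i) \<in> carrier G" "?e \<in> carrier G" "z \<in> carrier G"
    using assms c_closed e_closed z_closed by auto
  have "?e \<otimes> e i = ?e \<otimes> c i \<otimes> c (Suc i)" using cl by (simp add: e_def[of i] m_assoc)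
  also have "?e \<otimes> c i = c i \<otimes> ?e" using e_c[of "Suc i" i] assms by auto
  also have "c i \<otimes> ?e \<otimes> c (Suc i) = c i \<otimes> (?e \<otimes> c (Suc i))" using cl by (simp add: m_assoc)
  also have "?e \<otimes> c (Suc i) = z \<otimes> (c (Suc i) \<otimes> ?e)" using e_c[of "Suc i" "Suc i"] assms by auto
  finally show ?thesis using cl by (simp add: e_def[of i] m_assoc z_left_commute)
qed

section \<open>The subgroup \<open>N\<close> and its stability under the braid generators\<close>

definition N :: "'a set" where
  "N = generate G (insert z (e ` {1..m}))"

lemma N_gens_closed: "insert z (e ` {1..m}) \<subseteq> carrier G"
  using z_closed e_closed by auto

lemma N_subgroup: "subgroup N G"
  unfolding N_def by (rule generate_is_subgroup[OF N_gens_closed])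

lemma N_closed: "x \<in> N \<Longrightarrow> x \<in> carrier G"
  using subgroup.mem_carrier[OF N_subgroup] .

lemma z_N: "z \<in> N" and e_N: "i \<in> {1..m} \<Longrightarrow> e i \<in> N"
  by (auto simp: N_def intro: generate.incl)

lemma N_mult: "x \<in> N \<Longrightarrow> y \<in> N \<Longrightarrow> x \<otimes> y \<in> N"
  using subgroup.m_closed[OF N_subgroup] .

text \<open>Conjugation by \<open>s i\<close> fixes \<open>e j\<close> unless \<open>j\<close> and
  \<open>i\<close> are neighbours. Then it gives, up to \<open>z\<close>, a product of Majorana
  operators at distance two, which splits into two elements \<open>e\<close> after inserting the
  square of the operator between them.\<close>

lemma s_N:
  assumes i: "i \<in> {1..m}" and n: "n \<in> N"
  shows "\<exists>n'\<in>N. s i \<otimes> n = n' \<otimes> s i"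
proof -
  note cl = s_closed[OF i] z_closed
  have gen: "\<exists>n'\<in>N. s i \<otimes> h = n' \<otimes> s i" if h: "h \<in> insert z (e ` {1..m})" for h
  proof (cases "h = z")
    case True
    then show ?thesis using z_N z_central cl by auto
  next
    case False
    then obtain j where j: "j \<in> {1..m}" "h = e j" using h by blast
    have cj: "c j \<in> carrier G" "c (Suc j) \<in> carrier G" using j c_closed by auto
    have split: "s i \<otimes> h = s i \<otimes> c j \<otimes> c (Suc j)" using j cj cl by (simp add: e_def m_assoc)
    consider "j = i" | "i = Suc j" | "j = Suc i" | "i \<noteq> j" "i \<noteq> Suc j" "j \<noteq> Suc i" by blast
    then show ?thesis
    proof cases
      case 1
      \<comment> \<open>\<open>e i\<close> is the square of \<open>s i\<close>, so the two
        commute.\<close>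
      have "s i \<otimes> e i = e i \<otimes> s i" using s_sq[OF i] cl by (simp add: e_def m_assoc[symmetric] flip: s_sq[OF i])
      then show ?thesis using j 1 e_N by blast
    next
      case 2
      have c2: "c (Suc i) \<in> carrier G" using i c_closed by auto
      have "s i \<otimes> h = c j \<otimes> (s i \<otimes> c i)"
        unfolding split using s_c_other[OF i, of j] j cj cl 2 by (simp add: m_assoc)
      also have "\<dots> = z \<otimes> (c j \<otimes> c (Suc i)) \<otimes> s i"
        using s_c[OF i] cj c2 cl by (simp add: m_assoc z_left_commute)
      also have "c j \<otimes> c (Suc i) = c j \<otimes> (c i \<otimes> c i) \<otimes> c (Suc i)"
        using c_sq[of i] i cj by simp
      also have "\<dots> = e j \<otimes> e i" using cj c2 2 by (simp add: e_def m_assoc)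
      finally show ?thesis using z_N e_N[OF i] e_N[OF j(1)] N_mult by blast
    next
      case 3
      have c2: "c i \<in> carrier G" using i c_closed by auto
      have "s i \<otimes> h = c i \<otimes> (s i \<otimes> c (Suc j))"
        unfolding split using s_c_Suc[OF i] j cj c2 cl 3 by (simp add: m_assoc)
      also have "\<dots> = (c i \<otimes> c (Suc j)) \<otimes> s i"
        using s_c_other[OF i, of "Suc j"] j cj c2 cl 3 by (simp add: m_assoc)
      also have "c i \<otimes> c (Suc j) = c i \<otimes> (c j \<otimes> c j) \<otimes> c (Suc j)"
        using c_sq[of j] j c2 cj by simp
      also have "\<dots> = e i \<otimes> e j" using cj c2 3 by (simp add: e_def m_assoc)
      finally show ?thesis using e_N[OF i] e_N[OF j(1)] N_mult by blast
    next
      case 4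
      have "s i \<otimes> h = h \<otimes> s i"
        unfolding split using s_c_other[OF i, of j] s_c_other[OF i, of "Suc j"] j cj cl 4
        by (simp add: m_assoc e_def)
      then show ?thesis using j e_N by blast
    qed
  qed
  from n[unfolded N_def] show ?thesis
  proof induction
    case one
    show ?case using cl subgroup.one_closed[OF N_subgroup] by (intro bexI[of _ \<one>]) auto
  next
    case (incl h)
    then show ?case by (rule gen)
  next
    case (inv h)
    then have h: "h \<in> carrier G" using N_gens_closed by blast
    from gen[OF inv] obtain n' where n': "n' \<in> N" "s i \<otimes> h = n' \<otimes> s i" by blast
    have "s i \<otimes> inv h = inv n' \<otimes> (n' \<otimes> s i) \<otimes> inv h"
      using n' h cl N_closed by (simp add: m_assoc[symmetric])
    also have "\<dots> = inv n' \<otimes> s i"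
      using n' h cl N_closed by (simp add: m_assoc flip: n'(2))
    finally show ?case using subgroup.m_inv_closed[OF N_subgroup] n' by blast
  next
    case (eng x y)
    then obtain x' y' where x': "x' \<in> N" "s i \<otimes> x = x' \<otimes> s i" and y': "y' \<in> N" "s i \<otimes> y = y' \<otimes> s i"
      by blast
    have xy: "x \<in> carrier G" "y \<in> carrier G"
      using eng generate_in_carrier[OF N_gens_closed] by auto
    have "s i \<otimes> (x \<otimes> y) = x' \<otimes> (s i \<otimes> y)"
      using x' xy cl N_closed by (simp add: m_assoc[symmetric])
    also have "\<dots> = x' \<otimes> y' \<otimes> s i" using x' y' cl N_closed by (simp add: m_assoc[symmetric])
    finally show ?case using x' y' N_mult by blast
  qed
qed

section \<open>The signed permutation action and its kernel\<close>

text \<open>\<open>e i\<close> is the square of \<open>s i\<close>. This form meets the condition on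
  inverses in \<open>generate_subset_cosets\<close>, with \<open>inv (e i)\<close> in
  \<open>N\<close>.\<close>

lemma s_inv: "i \<in> {1..m} \<Longrightarrow> inv (s i) = s i \<otimes> inv (e i)"
proof -
  assume i: "i \<in> {1..m}"
  then have "inv (e i) = inv (s i) \<otimes> inv (s i)"
    using s_sq s_closed by (simp add: e_def inv_mult_group flip: s_sq)
  then show ?thesis using s_closed[OF i] by (simp add: m_assoc[symmetric])
qed

text \<open>Conjugation by \<open>A\<close> sends \<open>c k\<close> to \<open>c l\<close> up to
  sign. Forgetting the sign turns signed permutations into permutations.\<close>

definition moves :: "'a \<Rightarrow> nat \<Rightarrow> nat \<Rightarrow> bool" where
  "moves A k l \<longleftrightarrow> A \<otimes> c k = c l \<otimes> A \<or> A \<otimes> c k = z \<otimes> (c l \<otimes> A)"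

lemma moves_one: "k \<in> {1..Suc m} \<Longrightarrow> moves \<one> k k"
  using c_closed by (simp add: moves_def)

lemma moves_mult:
  assumes A: "A \<in> carrier G" "moves A k l" and B: "B \<in> carrier G" "moves B j k"
    and jkl: "j \<in> {1..Suc m}" "k \<in> {1..Suc m}" "l \<in> {1..Suc m}"
  shows "moves (A \<otimes> B) j l"
proof -
  note cl = A(1) B(1) z_closed c_closed[OF jkl(1)] c_closed[OF jkl(2)] c_closed[OF jkl(3)]
  have 1: "A \<otimes> B \<otimes> c j = A \<otimes> (B \<otimes> c j)" using cl by (simp add: m_assoc)
  have 2: "A \<otimes> (c k \<otimes> B) = A \<otimes> c k \<otimes> B" using cl by (simp add: m_assoc)
  have "A \<otimes> B \<otimes> c j = A \<otimes> c k \<otimes> B \<or> A \<otimes> B \<otimes> c j = z \<otimes> (A \<otimes> c k \<otimes> B)"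
    using B(2) unfolding moves_def 1 2[symmetric] using cl by (auto simp: z_left_commute)
  with A(2) show ?thesis
    using cl unfolding moves_def by (elim disjE) (simp_all add: m_assoc z_left_cancel)
qed

lemma moves_inv:
  assumes A: "A \<in> carrier G" "moves A k l" and kl: "k \<in> {1..Suc m}" "l \<in> {1..Suc m}"
  shows "moves (inv A) l k"
proof -
  note cl = A(1) z_closed c_closed[OF kl(1)] c_closed[OF kl(2)]
  have l: "inv A \<otimes> (c l \<otimes> A) \<otimes> inv A = inv A \<otimes> c l" using cl by (simp add: m_assoc)
  have k: "inv A \<otimes> (A \<otimes> c k) \<otimes> inv A = c k \<otimes> inv A" using cl by (simp add: m_assoc[symmetric])
  from A(2) show ?thesis unfolding moves_def
  proof
    assume "A \<otimes> c k = c l \<otimes> A"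
    then show "inv A \<otimes> c l = c k \<otimes> inv A \<or> inv A \<otimes> c l = z \<otimes> (c k \<otimes> inv A)"
      using l k by simp
  next
    assume a: "A \<otimes> c k = z \<otimes> (c l \<otimes> A)"
    have "z \<otimes> (inv A \<otimes> c l) = inv A \<otimes> (A \<otimes> c k) \<otimes> inv A"
      unfolding a using cl l by (simp add: m_assoc z_left_commute)
    then have "z \<otimes> (z \<otimes> (inv A \<otimes> c l)) = z \<otimes> (c k \<otimes> inv A)" using k by simp
    then show "inv A \<otimes> c l = c k \<otimes> inv A \<or> inv A \<otimes> c l = z \<otimes> (c k \<otimes> inv A)"
      using cl by (simp add: z_left_cancel)
  qed
qed

text \<open>Operators that agree up to a central sign commute, whereas distinct indices anticommute;
  both together would give \<open>z = \<one>\<close>.\<close>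

lemma c_neq:
  assumes kl: "k \<in> {1..Suc m}" "l \<in> {1..Suc m}" and eq: "c k = c l \<or> c k = z \<otimes> c l"
  shows "k = l"
proof (rule ccontr)
  assume "k \<noteq> l"
  note cl = c_closed[OF kl(1)] c_closed[OF kl(2)] z_closed
  from eq have "c k \<otimes> c l = c l \<otimes> c k" using cl by (auto simp: m_assoc z_left_commute)
  then have "\<one> \<otimes> (c l \<otimes> c k) = z \<otimes> (c l \<otimes> c k)" using c_anti[OF kl \<open>k \<noteq> l\<close>] cl by simp
  then show False using z_neq cl by (subst (asm) right_cancel) auto
qed

lemma moves_unique:
  assumes A: "A \<in> carrier G" "moves A k l" "moves A k l'"
    and l: "l \<in> {1..Suc m}" "l' \<in> {1..Suc m}"
  shows "l = l'"
proof (rule c_neq[OF l])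
  note cl = c_closed[OF l(1)] c_closed[OF l(2)] z_closed A(1)
  have "c l \<otimes> A = c l' \<otimes> A \<or> c l \<otimes> A = (z \<otimes> c l') \<otimes> A"
    using A(2,3) cl unfolding moves_def by (metis m_assoc m_closed z_left_cancel)
  then show "c l = c l' \<or> c l = z \<otimes> c l'" using cl by simp
qed

lemma moves_s:
  assumes "i \<in> {1..m}" "k \<in> {1..Suc m}"
  shows "moves (s i) k (Transposition.transpose i (Suc i) k)"
proof -
  consider "k = i" | "k = Suc i" | "k \<noteq> i" "k \<noteq> Suc i" by blast
  then show ?thesis
    using s_c[OF assms(1)] s_c_Suc[OF assms(1)] s_c_other[OF assms] by cases (simp_all add: moves_def)
qed

lemma moves_N:
  assumes "x \<in> N" and k: "k \<in> {1..Suc m}"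
  shows "moves x k k"
  using assms(1)[unfolded N_def]
proof induction
  case one
  show ?case using moves_one[OF k] .
next
  case (incl h)
  then show ?case using e_c[OF _ k] z_central[OF c_closed[OF k]] by (auto simp: moves_def)
next
  case (inv h)
  then have "moves h k k"
    using e_c[OF _ k] z_central[OF c_closed[OF k]] by (auto simp: moves_def)
  then show ?case using moves_inv[OF _ _ k k] inv N_gens_closed by blast
next
  case (eng x y)
  then show ?case using moves_mult[OF _ _ _ _ k k k] generate_in_carrier[OF N_gens_closed] by blast
qed

section \<open>The chain of subgroups \<open>H k\<close> and its coset representatives\<close>

definition H :: "nat \<Rightarrow> 'a set" where
  "H k = generate G (N \<union> s ` {1..k})"

lemma H_gens_closed: "k \<le> m \<Longrightarrow> N \<union> s ` {1..k} \<subseteq> carrier G"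
  using N_closed s_closed by auto

lemma H_subgroup: "k \<le> m \<Longrightarrow> subgroup (H k) G"
  unfolding H_def by (rule generate_is_subgroup[OF H_gens_closed])

lemma H_closed: "k \<le> m \<Longrightarrow> x \<in> H k \<Longrightarrow> x \<in> carrier G"
  using subgroup.mem_carrier[OF H_subgroup] .

lemma N_H: "x \<in> N \<Longrightarrow> x \<in> H k" and s_H: "i \<in> {1..k} \<Longrightarrow> s i \<in> H k"
  by (auto simp: H_def intro: generate.incl)

text \<open>The generators \<open>s i\<close> with \<open>i \<le> k\<close> exchange indices up to
  \<open>Suc k\<close> only, and \<open>N\<close> preserves every index.\<close>

lemma moves_H:
  assumes k: "k \<le> m" and x: "x \<in> H k" and l: "Suc k < l" "l \<le> Suc m"
  shows "moves x l l"
proof -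
  have l': "l \<in> {1..Suc m}" using l by simp
  have gen: "moves h l l" if "h \<in> N \<union> s ` {1..k}" for h
    using that
  proof
    assume "h \<in> s ` {1..k}"
    then obtain i where i: "i \<in> {1..k}" "h = s i" by blast
    then have "i \<in> {1..m}" "l \<noteq> i" "l \<noteq> Suc i" using k l by auto
    then show ?thesis using moves_s[of i l] l' i by simp
  qed (rule moves_N[OF _ l'])
  from x[unfolded H_def] show ?thesis
  proof induction
    case one
    show ?case using moves_one[OF l'] .
  next
    case (incl h)
    then show ?case by (rule gen)
  next
    case (inv h)
    then show ?case using moves_inv[OF _ gen l' l'] H_gens_closed[OF k] by blast
  next
    case (eng x y)
    then show ?case
      using moves_mult[OF _ _ _ _ l' l' l'] generate_in_carrier[OF H_gens_closed[OF k]] by blast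
  qed
qed

text \<open>Modulo \<open>N\<close>, these are the usual coset representatives of a symmetric group in the next larger
  one.\<close>

primrec desc :: "nat \<Rightarrow> nat \<Rightarrow> 'a" where
  "desc k 0 = \<one>"
| "desc k (Suc j) = desc k j \<otimes> s (k - j)"

lemma desc_closed: "k \<le> m \<Longrightarrow> j \<le> k \<Longrightarrow> desc k j \<in> carrier G"
  by (induction j) (auto intro!: m_closed s_closed)

text \<open>Each new factor on the right lowers the starting index by one and feeds into the shorter
  product. Products of different length thus send different indices to \<open>Suc k\<close>, which
  is what separates the cosets.\<close>

lemma moves_desc: "k \<le> m \<Longrightarrow> j \<le> k \<Longrightarrow> moves (desc k j) (Suc k - j) (Suc k)"
proof (induction j)
  case (Suc j)
  have "k - j \<in> {1..m}" "Suc k - Suc j \<in> {1..Suc m}" using Suc.prems by auto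
  then have "moves (s (k - j)) (Suc k - Suc j) (Suc k - j)"
    using moves_s[of "k - j" "k - j"] Suc.prems by (simp add: Suc_diff_le)
  with Suc show ?case
    by (auto intro!: moves_mult[of _ "Suc k - j"] desc_closed s_closed)
qed (simp add: moves_one)

text \<open>Every factor of \<open>desc k j\<close> has index at least \<open>i + 2\<close>, so only
  far commutation is involved.\<close>

lemma desc_s_below:
  "k \<le> m \<Longrightarrow> 1 \<le> i \<Longrightarrow> i + j < k \<Longrightarrow> desc k j \<otimes> s i = s i \<otimes> desc k j"
proof (induction j)
  case 0
  then show ?case using s_closed[of i] by simp
next
  case (Suc j)
  have i: "s i \<in> carrier G" "s (k - j) \<in> carrier G" "desc k j \<in> carrier G"
    using Suc.prems desc_closed by (auto intro!: s_closed)
  have "desc k (Suc j) \<otimes> s i = desc k j \<otimes> (s i \<otimes> s (k - j))"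
    using s_far[of i "k - j"] Suc.prems i by (simp add: m_assoc)
  also have "\<dots> = s i \<otimes> desc k (Suc j)"
    using Suc i by (simp add: m_assoc[symmetric])
  finally show ?case .
qed

text \<open>Here both \<open>s i\<close> and \<open>s (i - 1)\<close> occur in
  \<open>desc k j\<close>. The new factor moves left to this pair, is lowered to
  \<open>s (i - 1)\<close> by the braid relation, and then commutes with the remaining larger
  indices.\<close>

lemma desc_s_above:
  "k \<le> m \<Longrightarrow> j \<le> k \<Longrightarrow> i \<le> k \<Longrightarrow> Suc k < i + j \<Longrightarrow> desc k j \<otimes> s i = s (i - 1) \<otimes> desc k j"
proof (induction j)
  case (Suc j)
  have cl: "s i \<in> carrier G" "s (i - 1) \<in> carrier G" "s (k - j) \<in> carrier G" "desc k j \<in> carrier G"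
    using Suc.prems desc_closed by (auto intro!: s_closed)
  show ?case
  proof (cases "Suc k < i + j")
    case True
    have "desc k (Suc j) \<otimes> s i = desc k j \<otimes> (s i \<otimes> s (k - j))"
      using s_far[of "k - j" i] Suc.prems True cl by (simp add: m_assoc)
    also have "\<dots> = s (i - 1) \<otimes> desc k (Suc j)"
      using Suc True cl by (simp add: m_assoc[symmetric])
    finally show ?thesis .
  next
    \<comment> \<open>Now \<open>i + j = Suc k\<close>, so the product ends exactly in
      \<open>s i\<close> followed by \<open>s (i - 1)\<close>, and the braid relation
      applies.\<close>
    case False
    then have "j \<noteq> 0" "i \<noteq> 0" using Suc.prems by auto
    then obtain j' i' where j: "j = Suc j'" and i: "i = Suc i'"
      using not0_implies_Suc by blast
    have e: "k - j' = i" "k - j = i'" "1 \<le> i'" using False Suc.prems i j by auto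
    have cl': "desc k j' \<in> carrier G" "s i' \<in> carrier G"
      using Suc.prems j cl i by (auto intro: desc_closed)
    have br: "s i \<otimes> s i' \<otimes> s i = s i' \<otimes> s i \<otimes> s i'"
      using s_braid[of i'] e Suc.prems i by simp
    have "desc k (Suc j) \<otimes> s i = desc k j' \<otimes> (s i \<otimes> s i' \<otimes> s i)"
      using cl cl' e j by (simp add: m_assoc)
    also have "\<dots> = (desc k j' \<otimes> s i') \<otimes> s i \<otimes> s i'"
      unfolding br using cl cl' by (simp add: m_assoc)
    also have "desc k j' \<otimes> s i' = s i' \<otimes> desc k j'"
      using desc_s_below[of k i' j'] e Suc.prems j i by simp
    also have "s i' \<otimes> desc k j' \<otimes> s i \<otimes> s i' = s (i - 1) \<otimes> desc k (Suc j)"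
      using cl cl' e i j by (simp add: m_assoc)
    finally show ?thesis .
  qed
qed simp

lemma desc_N: "k \<le> m \<Longrightarrow> j \<le> k \<Longrightarrow> n \<in> N \<Longrightarrow> \<exists>n'\<in>N. desc k j \<otimes> n = n' \<otimes> desc k j"
proof (induction j arbitrary: n)
  case 0
  then show ?case using N_closed by auto
next
  case (Suc j)
  have i: "k - j \<in> {1..m}" using Suc.prems by auto
  note cl = s_closed[OF i] desc_closed[OF Suc.prems(1), of j]
  from s_N[OF i Suc.prems(3)] obtain n' where n': "n' \<in> N" "s (k - j) \<otimes> n = n' \<otimes> s (k - j)" by blast
  from Suc n'(1) obtain n'' where n'': "n'' \<in> N" "desc k j \<otimes> n' = n'' \<otimes> desc k j" by force
  have "desc k (Suc j) \<otimes> n = desc k j \<otimes> n' \<otimes> s (k - j)"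
    using cl n' Suc.prems N_closed by (simp add: m_assoc)
  also have "\<dots> = n'' \<otimes> desc k (Suc j)" using n'' cl Suc.prems N_closed by (simp add: m_assoc)
  finally show ?case using n'' by blast
qed

text \<open>Right multiplication of a representative by \<open>s i\<close> has four outcomes:
  \<open>s i\<close> moves to the left unchanged, lengthens the product, shortens it up to
  \<open>N\<close>, or moves to the left with its index lowered.\<close>

lemma H_Suc:
  assumes k: "Suc k \<le> m" and x: "x \<in> H (Suc k)"
  shows "\<exists>h\<in>H k. \<exists>j\<le>Suc k. x = h \<otimes> desc (Suc k) j"
proof -
  let ?k = "Suc k"
  have "\<exists>h\<in>H k. \<exists>t\<in>desc ?k ` {..?k}. x = h \<otimes> t"
  proof (rule generate_subset_cosets[OF H_subgroup _ _ H_gens_closed[OF k] _ _ x[unfolded H_def]])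
    fix y assume y: "y \<in> N \<union> s ` {1..?k}"
    show "inv y \<in> N \<union> s ` {1..?k} \<or> (\<exists>y'\<in>N \<union> s ` {1..?k}. inv y = y \<otimes> y')"
    proof (cases "y \<in> N")
      case True
      then show ?thesis using subgroup.m_inv_closed[OF N_subgroup] by blast
    next
      case False
      then obtain i where "i \<in> {1..?k}" "y = s i" using y by blast
      then have i: "i \<in> {1..m}" "y = s i" using k by auto
      then show ?thesis using s_inv[OF i(1)] subgroup.m_inv_closed[OF N_subgroup e_N] by blast
    qed
    fix t assume "t \<in> desc ?k ` {..?k}"
    then obtain j where j: "j \<le> ?k" "t = desc ?k j" by auto
    show "\<exists>h\<in>H k. \<exists>t'\<in>desc ?k ` {..?k}. t \<otimes> y = h \<otimes> t'"
    proof (cases "y \<in> N")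
      case True
      then show ?thesis using desc_N[OF k j(1)] j N_H[of _ k] by blast
    next
      case False
      then obtain i where i: "i \<in> {1..?k}" "y = s i" using y by blast
      then have im: "i \<in> {1..m}" using k by auto
      note cl = desc_closed[OF k j(1)] s_closed[OF im]
      consider "i + j < ?k" | "i + j = ?k" | "i + j = Suc ?k" | "Suc ?k < i + j" by linarith
      then show ?thesis
      proof cases
        case 1
        then have "t \<otimes> y = s i \<otimes> desc ?k j" "i \<in> {1..k}"
          using desc_s_below[OF k _ 1] i j by auto
        then show ?thesis using s_H j(1) by blast
      next
        case 2
        then have "?k - j = i" by simp
        then have "t \<otimes> y = desc ?k (Suc j)" by (simp only: desc.simps i j)
        moreover have j': "Suc j \<le> ?k" using i 2 by auto
        ultimately have "t \<otimes> y = \<one> \<otimes> desc ?k (Suc j)"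
          using desc_closed[OF k j'] by (simp only: l_one)
        moreover have "\<one> \<in> H k" using subgroup.one_closed[OF H_subgroup[of k]] k by simp
        ultimately show ?thesis using j' by blast
      next
        case 3
        \<comment> \<open>The product ends in \<open>s i\<close>, so the square \<open>e i\<close>
          appears; \<open>desc_N\<close> carries it to the left as an element of
          \<open>N\<close>.\<close>
        then obtain j' where j': "j = Suc j'" using i by (cases j) auto
        then have e: "?k - j' = i" "j' \<le> ?k" using 3 j by auto
        have cl': "desc ?k j' \<in> carrier G" using e desc_closed[OF k] by blast
        have "t \<otimes> y = desc ?k j' \<otimes> e i"
          unfolding j i j' using s_sq[OF im] cl cl' e by (simp add: m_assoc e_def)
        with desc_N[OF k e(2) e_N[OF im]] show ?thesis using N_H e by force
      next
        case 4
        then have "t \<otimes> y = s (i - 1) \<otimes> desc ?k j" "i - 1 \<in> {1..k}"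
          using desc_s_above[OF k j(1) _ 4] i j by auto
        then show ?thesis using s_H j(1) by blast
      qed
    qed
  next
    show "desc ?k ` {..?k} \<subseteq> carrier G" using desc_closed[OF k] by auto
    show "\<one> \<in> desc ?k ` {..?k}" by (rule image_eqI[of _ _ 0]) auto
  qed (use k in simp)
  then show ?thesis by auto
qed

lemma H_fixing:
  assumes "k \<le> m" "x \<in> H k" "\<And>l. l \<in> {1..Suc m} \<Longrightarrow> moves x l l"
  shows "x \<in> N"
  using assms
proof (induction k arbitrary: x)
  case 0
  \<comment> \<open>\<open>H 0\<close> is generated by \<open>N\<close> alone.\<close>
  then show ?case using generate_subgroup_incl[OF _ N_subgroup, of N] by (auto simp: H_def)
next
  case (Suc k)
  then obtain h j where h: "h \<in> H k" "j \<le> Suc k" "x = h \<otimes> desc (Suc k) j" using H_Suc by blast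
  have hc: "h \<in> carrier G" using H_closed[of k] h Suc.prems by auto
  show ?case
  proof (cases "j = 0")
    case True
    then have "x = h" using h hc by simp
    then show ?thesis using Suc h by auto
  next
    case False
    let ?l = "Suc (Suc k) - j"
    have l: "?l \<in> {1..Suc m}" "Suc (Suc k) \<in> {1..Suc m}" using Suc.prems h by auto
    \<comment> \<open>\<open>h\<close> preserves the top index by \<open>moves_H\<close>, so
      \<open>x\<close> sends \<open>?l\<close> where the descending product does.\<close>
    have "moves x ?l (Suc (Suc k))"
      unfolding h(3)
      using moves_mult[OF hc moves_H[of k h] desc_closed moves_desc l(1) l(2,2)] h Suc.prems by simp
    moreover have "moves x ?l ?l" using Suc.prems l by blast
    ultimately have "?l = Suc (Suc k)"
      using moves_unique[of x ?l] l H_closed[OF Suc.prems(1,2)] by blast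
    then show ?thesis using False h by simp
  qed
qed

section \<open>The homomorphism onto the symmetric group\<close>

abbreviation S :: "'a set" where
  "S \<equiv> generate G (s ` {1..m})"

lemma S_gens_closed: "s ` {1..m} \<subseteq> carrier G"
  using s_closed by auto

lemma S_closed: "x \<in> S \<Longrightarrow> x \<in> carrier G"
  using generate_in_carrier[OF S_gens_closed] .

text \<open>Each \<open>e i\<close> is the square of a braid generator, and \<open>z\<close> is the
  square of \<open>e 1\<close>, which exists because \<open>1 \<le> m\<close>.\<close>

lemma N_subset_S:
  assumes "1 \<le> m"
  shows "N \<subseteq> S"
proof -
  have sub: "subgroup S G" by (rule generate_is_subgroup[OF S_gens_closed])
  have e: "e i \<in> S" if "i \<in> {1..m}" for i
    unfolding e_def s_sq[OF that, symmetric] using that by (intro generate.eng generate.incl) auto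
  have "1 \<in> {1..m}" using assms by simp
  then have "z \<in> S" using e e_sq generate.eng by metis
  then show ?thesis
    unfolding N_def using e by (intro generate_subgroup_incl[OF _ sub]) auto
qed

text \<open>That \<open>p\<close> permutes \<open>{1..Suc m}\<close> also fixes its values
  elsewhere, so \<open>p\<close> is determined by \<open>A\<close> as a function on all naturals and
  lies in \<open>sym_group (Suc m)\<close>.\<close>

definition has_perm :: "'a \<Rightarrow> (nat \<Rightarrow> nat) \<Rightarrow> bool" where
  "has_perm A p \<longleftrightarrow> p permutes {1..Suc m} \<and> (\<forall>k\<in>{1..Suc m}. moves A k (p k))"

lemma has_perm_one: "has_perm \<one> id"
  using moves_one by (simp add: has_perm_def permutes_id)

lemma has_perm_mult:
  assumes "A \<in> carrier G" "B \<in> carrier G" "has_perm A p" "has_perm B q"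
  shows "has_perm (A \<otimes> B) (p \<circ> q)"
proof -
  have pq: "p permutes {1..Suc m}" "q permutes {1..Suc m}" using assms by (auto simp: has_perm_def)
  have "moves (A \<otimes> B) k (p (q k))" if k: "k \<in> {1..Suc m}" for k
  proof -
    have q: "q k \<in> {1..Suc m}" "p (q k) \<in> {1..Suc m}"
      using k permutes_in_image[OF pq(1)] permutes_in_image[OF pq(2)] by blast+
    show ?thesis
      using assms k q by (intro moves_mult[of A "q k"]) (simp_all only: has_perm_def)
  qed
  then show ?thesis using permutes_compose[OF pq(2,1)] by (simp add: has_perm_def)
qed

lemma has_perm_inv:
  assumes "A \<in> carrier G" "has_perm A p"
  shows "has_perm (inv A) (Hilbert_Choice.inv p)"
proof -
  let ?q = "Hilbert_Choice.inv p"
  have p: "p permutes {1..Suc m}" using assms by (simp add: has_perm_def)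
  have "moves (inv A) k (?q k)" if k: "k \<in> {1..Suc m}" for k
  proof -
    have q: "?q k \<in> {1..Suc m}" using k permutes_in_image[OF permutes_inv[OF p]] by blast
    then have "moves A (?q k) k"
      using assms(2) permutes_inverses(1)[OF p, of k] unfolding has_perm_def by metis
    then show ?thesis by (rule moves_inv[OF assms(1) _ q k])
  qed
  then show ?thesis using permutes_inv[OF p] by (simp add: has_perm_def)
qed

lemma has_perm_s:
  assumes i: "i \<in> {1..m}"
  shows "has_perm (s i) (Transposition.transpose i (Suc i))"
  unfolding has_perm_def using i moves_s[OF i] by (auto intro!: permutes_swap_id)

lemma has_perm_unique:
  assumes A: "A \<in> carrier G" "has_perm A p" "has_perm A q"
  shows "p = q"
proof
  fix k
  have pq: "p permutes {1..Suc m}" "q permutes {1..Suc m}" using A by (auto simp: has_perm_def)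
  show "p k = q k"
  proof (cases "k \<in> {1..Suc m}")
    case True
    then have "p k \<in> {1..Suc m}" "q k \<in> {1..Suc m}"
      using permutes_in_image[OF pq(1)] permutes_in_image[OF pq(2)] by blast+
    with True A show ?thesis by (intro moves_unique[of A k]) (simp_all only: has_perm_def)
  next
    case False
    then show ?thesis using permutes_not_in[OF pq(1)] permutes_not_in[OF pq(2)] by simp
  qed
qed

lemma has_perm_ex:
  assumes "A \<in> S"
  shows "\<exists>p. has_perm A p"
  using assms
proof induction
  case (inv h)
  then show ?case using has_perm_s has_perm_inv s_closed by blast
next
  case (eng x y)
  then show ?case using has_perm_mult S_closed by blast
qed (use has_perm_one has_perm_s in blast)+

definition perm_of :: "'a \<Rightarrow> nat \<Rightarrow> nat" where
  "perm_of A = (THE p. has_perm A p)"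

lemma perm_of_eq: "A \<in> carrier G \<Longrightarrow> has_perm A p \<Longrightarrow> perm_of A = p"
  unfolding perm_of_def using has_perm_unique by blast

lemma has_perm_perm_of: "A \<in> S \<Longrightarrow> has_perm A (perm_of A)"
  using has_perm_ex perm_of_eq S_closed by blast

text \<open>Permutations are products of transpositions, each of these is a product of adjacent
  ones, and the adjacent ones come from the \<open>s i\<close>.\<close>

lemma perm_of_surj:
  assumes "p permutes {1..Suc m}"
  shows "\<exists>A\<in>S. has_perm A p"
  using assms finite_atLeastAtMost[of 1 "Suc m"]
proof (induction rule: permutes_induct)
  case id
  show ?case using has_perm_one generate.one by blast
next
  case (swap a b p)
  have adj: "\<exists>A\<in>S. has_perm A (apply_adj_transps xs)" if "set xs \<subseteq> {1..m}" for xs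
    using that
  proof (induction xs)
    case Nil
    then show ?case using has_perm_one generate.one by (auto simp: id_def[symmetric])
  next
    case (Cons i xs)
    then obtain A where A: "A \<in> S" "has_perm A (apply_adj_transps xs)" by auto
    have i: "i \<in> {1..m}" using Cons by simp
    have "has_perm (s i \<otimes> A) (apply_adj_transps (i # xs))"
      using has_perm_mult[OF s_closed[OF i] S_closed[OF A(1)] has_perm_s[OF i] A(2)] by simp
    moreover have "s i \<otimes> A \<in> S" using i by (intro generate.eng[OF generate.incl A(1)]) auto
    ultimately show ?case by blast
  qed
  have less: "\<exists>A\<in>S. has_perm A (Transposition.transpose i j)"
    if "i < j" "i \<in> {1..Suc m}" "j \<in> {1..Suc m}" for i j
  proof -
    \<comment> \<open>The adjacent transpositions used start below \<open>j \<le> Suc m\<close>, so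
      each has a braid generator.\<close>
    have "set (adj_transp_seq i j) \<subseteq> {1..m}" using that by (subst set_adj_transp_seq) auto
    from adj[OF this] show ?thesis using adj_transp_seq_correct[OF that(1)] by simp
  qed
  have "\<exists>A\<in>S. has_perm A (Transposition.transpose a b)"
  proof (cases "a < b")
    case True
    then show ?thesis using less swap by blast
  next
    case False
    then show ?thesis using less[of b a] swap by (simp add: transpose_commute)
  qed
  then obtain A where A: "A \<in> S" "has_perm A (Transposition.transpose a b)" by blast
  from swap.IH obtain B where B: "B \<in> S" "has_perm B p" by blast
  have "has_perm (A \<otimes> B) (Transposition.transpose a b \<circ> p)"
    by (intro has_perm_mult S_closed A B)
  moreover have "A \<otimes> B \<in> S" by (intro generate.eng A B)
  ultimately show ?case by blast
qed

lemma perm_of_epi: "perm_of \<in> epi (G\<lparr>carrier := S\<rparr>) (sym_group (Suc m))"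
proof -
  have "perm_of A permutes {1..Suc m}" if "A \<in> S" for A
    using has_perm_perm_of[OF that] by (simp add: has_perm_def)
  moreover have "perm_of (A \<otimes> B) = perm_of A \<circ> perm_of B" if "A \<in> S" "B \<in> S" for A B
    using that by (intro perm_of_eq has_perm_mult) (auto simp: S_closed has_perm_perm_of)
  moreover have "\<exists>A\<in>S. p = perm_of A" if "p permutes {1..Suc m}" for p
    using perm_of_surj[OF that] perm_of_eq S_closed by blast
  ultimately show ?thesis
    by (auto simp: epi_def hom_def sym_group_def image_iff simp del: One_nat_def)
qed

lemma kernel_perm_of:
  assumes "1 \<le> m"
  shows "kernel (G\<lparr>carrier := S\<rparr>) (sym_group (Suc m)) perm_of = N"
proof (intro equalityI subsetI)
  fix A assume "A \<in> kernel (G\<lparr>carrier := S\<rparr>) (sym_group (Suc m)) perm_of"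
  then have A: "A \<in> S" "perm_of A = id" by (auto simp: kernel_def sym_group_def)
  \<comment> \<open>\<open>H m\<close> has the generators of \<open>S\<close> and \<open>N\<close>
    besides, so \<open>H_fixing\<close> applies.\<close>
  have "S \<subseteq> H m" unfolding H_def by (intro mono_generate) auto
  moreover have "moves A l l" if "l \<in> {1..Suc m}" for l
    using has_perm_perm_of[OF A(1)] A(2) that by (simp add: has_perm_def)
  ultimately show "A \<in> N" using H_fixing[of m A] A by auto
next
  fix A assume A: "A \<in> N"
  then have "has_perm A id" using moves_N by (simp add: has_perm_def permutes_id)
  then have "perm_of A = id" using perm_of_eq N_closed[OF A] by blast
  then show "A \<in> kernel (G\<lparr>carrier := S\<rparr>) (sym_group (Suc m)) perm_of"
    using A N_subset_S[OF assms] by (auto simp: kernel_def sym_group_def)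
qed

section \<open>The embedding of the abstract group\<close>

fun E_image :: "egen \<Rightarrow> 'a" where
  "E_image Minus_one = z"
| "E_image (X i) = e i"

lemma E_image_closed: "E_image \<in> E_gens m \<rightarrow> carrier G"
  using z_closed e_closed by (auto simp: E_gens_def)

lemma E_image_rels:
  assumes "(r, t) \<in> E_rels m (-1)"
  shows "word_eval G E_image r = word_eval G E_image t"
proof -
  from assms consider
    (z) "r = pos_word [Minus_one, Minus_one]" "t = []"
  | (central) i where "i \<in> {1..m}" "r = pos_word [Minus_one, X i]" "t = pos_word [X i, Minus_one]"
  | (sq) i where "i \<in> {1..m}" "r = pos_word [X i, X i]" "t = pos_word [Minus_one]"
  | (far) i j where "i \<in> {1..m}" "j \<in> {1..m}" "\<bar>int i - int j\<bar> \<ge> 2"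
      "r = pos_word [X i, X j]" "t = pos_word [X j, X i]"
  | (near) i where "i \<in> {1..m-1}" "r = pos_word [X (i+1), X i]"
      "t = pos_word [Minus_one, X i, X (i+1)]"
    unfolding E_rels_def sign_word_def by auto
  then show ?thesis
  proof cases
    case z
    then show ?thesis using z_sq z_closed by (simp add: pos_word_def)
  next
    case central
    then show ?thesis using z_central[OF e_closed] e_closed z_closed by (simp add: pos_word_def)
  next
    case sq
    then show ?thesis using e_sq e_closed z_closed by (simp add: pos_word_def)
  next
    case far
    then have "i + 2 \<le> j \<or> j + 2 \<le> i" by linarith
    then show ?thesis using e_far[OF far(1,2)] far e_closed by (simp add: pos_word_def)
  next
    case near
    then have i: "i \<in> {1..m}" "Suc i \<in> {1..m}" by auto
    then show ?thesis using e_Suc[OF i] near e_closed z_closed by (simp add: pos_word_def)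
  qed
qed

abbreviation E_hom :: "egen word set \<Rightarrow> 'a" where
  "E_hom \<equiv> pres_lift G E_image"

lemma E_hom_hom: "E_hom \<in> hom (E_group m (-1)) G"
  unfolding E_group_def by (rule pres_lift_hom[OF E_image_closed E_image_rels])

lemma E_hom_range: "E_hom ` carrier (E_group m (-1)) = N"
proof -
  have "E_image ` E_gens m = insert z (e ` {1..m})" by (auto simp: E_gens_def image_image)
  then show ?thesis
    unfolding E_group_def N_def using pres_lift_image[OF E_image_closed E_image_rels] by simp
qed

text \<open>In the abstract group only the defining relations are at hand. They give normal forms in
  growing subgroups \<open>V k\<close>, and the Majorana operators in \<open>G\<close> tell these
  forms apart.\<close>

lemma E_hom_inj: "inj_on E_hom (carrier (E_group m (-1)))"
proof -
  let ?E = "E_group m (-1)"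
  interpret E: group ?E unfolding E_group_def by (rule group_presented)
  interpret h: group_hom ?E G E_hom by unfold_locales (rule E_hom_hom)
  define g where "g = pres_gen (E_gens m) (E_rels m (-1))"
  define w where "w = g Minus_one"
  define x where "x i = g (X i)" for i
  have gens: "Minus_one \<in> E_gens m" "i \<in> {1..m} \<Longrightarrow> X i \<in> E_gens m" for i
    by (auto simp: E_gens_def)
  have gcl: "g \<in> E_gens m \<rightarrow> carrier ?E" unfolding g_def E_group_def by (rule pres_gen_closed)
  have wcl: "w \<in> carrier ?E" and xcl: "\<And>i. i \<in> {1..m} \<Longrightarrow> x i \<in> carrier ?E"
    using gcl gens by (auto simp: w_def x_def Pi_iff)
  have rel: "word_eval ?E g r = word_eval ?E g t"
    if "(r, t) \<in> E_rels m (-1)" "r \<in> words (E_gens m)" "t \<in> words (E_gens m)" for r t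
    unfolding g_def E_group_def by (rule presented_rel[OF that])
  have ww: "w \<otimes>\<^bsub>?E\<^esub> w = \<one>\<^bsub>?E\<^esub>"
    using rel[of "pos_word [Minus_one, Minus_one]" "[]"] wcl gens
    by (simp add: E_rels_def pos_word_def w_def)
  have wx: "x i \<otimes>\<^bsub>?E\<^esub> w = w \<otimes>\<^bsub>?E\<^esub> x i" if "i \<in> {1..m}" for i
    using rel[of "pos_word [Minus_one, X i]" "pos_word [X i, Minus_one]"] wcl xcl[OF that] gens that
    by (simp add: E_rels_def pos_word_def w_def x_def)
  have xx: "x i \<otimes>\<^bsub>?E\<^esub> x i = w" if "i \<in> {1..m}" for i
    using rel[of "pos_word [X i, X i]" "pos_word [Minus_one]"] wcl xcl[OF that] gens that
    by (simp add: E_rels_def pos_word_def sign_word_def w_def x_def)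
  have far: "x j \<otimes>\<^bsub>?E\<^esub> x i = x i \<otimes>\<^bsub>?E\<^esub> x j" if "i \<in> {1..m}" "j \<in> {1..m}" "i + 2 \<le> j" for i j
  proof -
    have "(pos_word [X j, X i], pos_word [X i, X j]) \<in> E_rels m (-1)"
      unfolding E_rels_def
      by (rule UnI1, rule UnI2, rule CollectI, rule exI[of _ j], rule exI[of _ i]) (use that in auto)
    from rel[OF this] show ?thesis using xcl[OF that(1)] xcl[OF that(2)] gens that
      by (simp add: pos_word_def w_def x_def)
  qed
  have near: "x (Suc i) \<otimes>\<^bsub>?E\<^esub> x i = w \<otimes>\<^bsub>?E\<^esub> (x i \<otimes>\<^bsub>?E\<^esub> x (Suc i))"
    if "i \<in> {1..m}" "Suc i \<in> {1..m}" for i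
  proof -
    have "(pos_word [X (i+1), X i], pos_word [Minus_one, X i, X (i+1)]) \<in> E_rels m (-1)"
      unfolding E_rels_def using that by auto
    from rel[OF this] show ?thesis using wcl xcl[OF that(1)] xcl[OF that(2)] gens that
      by (simp add: pos_word_def w_def x_def)
  qed
  have hw: "E_hom w = z" and hx: "\<And>i. i \<in> {1..m} \<Longrightarrow> E_hom (x i) = e i"
    unfolding w_def x_def g_def using pres_lift_gen[OF E_image_closed E_image_rels] gens by auto

  \<comment> \<open>\<open>w\<close> belongs to every \<open>Y k\<close> because the inverse of
    \<open>x i\<close> is \<open>x i\<close> times \<open>w\<close>, as the condition on inverses in
    \<open>generate_subset_cosets\<close> asks.\<close>
  define Y where "Y k = {\<one>\<^bsub>?E\<^esub>, w} \<union> x ` {1..k}" for k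
  define V where "V k = generate ?E (Y k)" for k
  have Ycl: "Y k \<subseteq> carrier ?E" if "k \<le> m" for k using that wcl xcl by (auto simp: Y_def)
  have Vcl: "y \<in> carrier ?E" if "k \<le> m" "y \<in> V k" for k y
    using that E.generate_in_carrier[OF Ycl] by (auto simp: V_def)
  have Vsub: "subgroup (V k) ?E" if "k \<le> m" for k
    unfolding V_def by (rule E.generate_is_subgroup[OF Ycl[OF that]])
  have Yinv: "inv\<^bsub>?E\<^esub> y \<in> Y k \<or> (\<exists>y'\<in>Y k. inv\<^bsub>?E\<^esub> y = y \<otimes>\<^bsub>?E\<^esub> y')"
    if "k \<le> m" "y \<in> Y k" for k y
  proof -
    have "inv\<^bsub>?E\<^esub> w = w" using ww wcl by (intro E.inv_equality) auto
    moreover have "inv\<^bsub>?E\<^esub> x i = x i \<otimes>\<^bsub>?E\<^esub> w" if "i \<in> {1..k}" for i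
    proof -
      have i: "i \<in> {1..m}" using that \<open>k \<le> m\<close> by auto
      show ?thesis using ww wx[OF i] xx[OF i] wcl xcl[OF i]
        by (intro E.inv_equality) (auto simp: E.m_assoc)
    qed
    ultimately show ?thesis using that by (auto simp: Y_def)
  qed
  \<comment> \<open>Images of \<open>V k\<close> involve only \<open>z\<close> and
    \<open>e i\<close> with \<open>i \<le> k\<close>, hence Majorana indices up to
    \<open>Suc k\<close>.\<close>
  have commute: "E_hom y \<otimes> c l = c l \<otimes> E_hom y"
    if "k \<le> m" "y \<in> V k" "Suc k < l" "l \<le> Suc m" for k l y
  proof -
    have l: "l \<in> {1..Suc m}" using that by simp
    note cl = c_closed[OF l]
    have gen: "E_hom h \<otimes> c l = c l \<otimes> E_hom h" if "h \<in> Y k" for h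
      using that e_c[OF _ l] z_central[OF cl] cl hw hx \<open>k \<le> m\<close> \<open>Suc k < l\<close> by (auto simp: Y_def)
    from \<open>y \<in> V k\<close>[unfolded V_def] show ?thesis
    proof induction
      case one
      show ?case using cl by simp
    next
      case (incl h)
      then show ?case by (rule gen)
    next
      case (inv h)
      then have h: "h \<in> carrier ?E" using Ycl[OF \<open>k \<le> m\<close>] by blast
      let ?h = "E_hom h"
      have hc: "?h \<in> carrier G" using h by simp
      have "inv ?h \<otimes> c l = inv ?h \<otimes> (c l \<otimes> ?h) \<otimes> inv ?h" using hc cl by (simp add: m_assoc)
      also have "\<dots> = c l \<otimes> inv ?h" using hc cl by (simp add: m_assoc[symmetric] flip: gen[OF inv])
      finally show ?case using h by simp
    next
      case (eng a b)
      then have ab: "a \<in> carrier ?E" "b \<in> carrier ?E"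
        using E.generate_in_carrier[OF Ycl[OF \<open>k \<le> m\<close>]] by auto
      then have hc: "E_hom a \<in> carrier G" "E_hom b \<in> carrier G" by simp_all
      have "E_hom a \<otimes> E_hom b \<otimes> c l = E_hom a \<otimes> c l \<otimes> E_hom b"
        using eng.IH(2) hc cl by (simp add: m_assoc)
      also have "\<dots> = c l \<otimes> (E_hom a \<otimes> E_hom b)"
        unfolding eng.IH(1) using hc cl by (simp add: m_assoc)
      finally show ?case using ab by simp
    qed
  qed
  have inj: "y = \<one>\<^bsub>?E\<^esub>" if "k \<le> m" "y \<in> V k" "E_hom y = \<one>" for k y
    using that
  proof (induction k arbitrary: y)
    case 0
    \<comment> \<open>At the bottom only \<open>\<one>\<close> and \<open>w\<close> remain, and the
      image \<open>z\<close> of \<open>w\<close> is not \<open>\<one>\<close>.\<close>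
    have "\<exists>k\<in>{\<one>\<^bsub>?E\<^esub>}. \<exists>t\<in>{\<one>\<^bsub>?E\<^esub>, w}. y = k \<otimes>\<^bsub>?E\<^esub> t"
    proof (rule E.generate_subset_cosets[OF E.triv_subgroup _ _ Ycl[of 0]])
      show "y \<in> generate ?E (Y 0)" using 0 by (simp add: V_def)
      show "inv\<^bsub>?E\<^esub> a \<in> Y 0 \<or> (\<exists>b\<in>Y 0. inv\<^bsub>?E\<^esub> a = a \<otimes>\<^bsub>?E\<^esub> b)" if "a \<in> Y 0" for a
        by (rule Yinv[OF _ that]) simp
      show "\<exists>k\<in>{\<one>\<^bsub>?E\<^esub>}. \<exists>t'\<in>{\<one>\<^bsub>?E\<^esub>, w}. t \<otimes>\<^bsub>?E\<^esub> a = k \<otimes>\<^bsub>?E\<^esub> t'"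
        if "t \<in> {\<one>\<^bsub>?E\<^esub>, w}" "a \<in> Y 0" for t a
      proof -
        have "a \<in> {\<one>\<^bsub>?E\<^esub>, w}" using that by (simp add: Y_def)
        with that(1) have ta: "t \<otimes>\<^bsub>?E\<^esub> a \<in> {\<one>\<^bsub>?E\<^esub>, w}"
          using ww wcl by (elim insertE emptyE) simp_all
        have "t \<otimes>\<^bsub>?E\<^esub> a \<in> carrier ?E"
          using ta wcl by (elim insertE emptyE) simp_all
        then have "t \<otimes>\<^bsub>?E\<^esub> a = \<one>\<^bsub>?E\<^esub> \<otimes>\<^bsub>?E\<^esub> (t \<otimes>\<^bsub>?E\<^esub> a)" by simp
        with ta show ?thesis by blast
      qed
    qed (use wcl in auto)
    then show ?case using wcl hw z_neq 0 by auto
  next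
    case (Suc k)
    then have k: "k \<le> m" "Suc k \<in> {1..m}" by auto
    note xk = xcl[OF k(2)]
    have VY: "a \<in> V k" if "a \<in> Y k" for a using that by (auto simp: V_def intro: generate.incl)
    have "\<exists>h\<in>V k. \<exists>t\<in>{\<one>\<^bsub>?E\<^esub>, x (Suc k)}. y = h \<otimes>\<^bsub>?E\<^esub> t"
    proof (rule E.generate_subset_cosets[OF Vsub[OF k(1)] _ _ Ycl[OF Suc.prems(1)]])
      show "y \<in> generate ?E (Y (Suc k))" using Suc by (simp add: V_def)
    next
      fix t y assume t: "t \<in> {\<one>\<^bsub>?E\<^esub>, x (Suc k)}" and y: "y \<in> Y (Suc k)"
      have ycl: "y \<in> carrier ?E" using y Ycl[OF Suc.prems(1)] by blast
      have one: "\<one>\<^bsub>?E\<^esub> \<in> Y k" "w \<in> Y k" by (auto simp: Y_def)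
      consider (new) "y = x (Suc k)" | (old) "y \<in> Y k"
        using y by (auto simp: Y_def atLeastAtMostSuc_conv)
      then show "\<exists>h\<in>V k. \<exists>t'\<in>{\<one>\<^bsub>?E\<^esub>, x (Suc k)}. t \<otimes>\<^bsub>?E\<^esub> y = h \<otimes>\<^bsub>?E\<^esub> t'"
      proof cases
        case new
        \<comment> \<open>The square of \<open>x (Suc k)\<close> is \<open>w\<close>, which lies in
          \<open>V k\<close>.\<close>
        have "t \<otimes>\<^bsub>?E\<^esub> y = \<one>\<^bsub>?E\<^esub> \<otimes>\<^bsub>?E\<^esub> x (Suc k) \<or> t \<otimes>\<^bsub>?E\<^esub> y = w \<otimes>\<^bsub>?E\<^esub> \<one>\<^bsub>?E\<^esub>"
          using t new xx[OF k(2)] xk wcl by auto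
        then show ?thesis using VY one by blast
      next
        case old
        show ?thesis
        proof (cases "t = \<one>\<^bsub>?E\<^esub>")
          case True
          then have "t \<otimes>\<^bsub>?E\<^esub> y = y \<otimes>\<^bsub>?E\<^esub> \<one>\<^bsub>?E\<^esub>" using ycl by simp
          then show ?thesis using VY[OF old] by blast
        next
          case False
          then have t: "t = x (Suc k)" using t by simp
          consider "y = \<one>\<^bsub>?E\<^esub>" | "y = w" | i where "i \<in> {1..k}" "y = x i"
            using old by (auto simp: Y_def)
          \<comment> \<open>Moving \<open>x (Suc k)\<close> to the right past a generator of
            \<open>V k\<close> costs at most a factor \<open>w\<close>, which \<open>V k\<close>
            absorbs.\<close>
          then have "t \<otimes>\<^bsub>?E\<^esub> y = y \<otimes>\<^bsub>?E\<^esub> t \<or> t \<otimes>\<^bsub>?E\<^esub> y = (w \<otimes>\<^bsub>?E\<^esub> y) \<otimes>\<^bsub>?E\<^esub> t"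
          proof cases
            case 1
            then show ?thesis using t xk by simp
          next
            case 2
            then show ?thesis using t wx[OF k(2)] by simp
          next
            case 3
            then have i: "i \<in> {1..m}" using k by auto
            show ?thesis
            proof (cases "i = k")
              case True
              then show ?thesis using near[of k] 3 i k(2) t wcl xk ycl by (simp add: E.m_assoc)
            next
              case False
              then show ?thesis using far[OF i k(2)] 3 t by auto
            qed
          qed
          moreover have "w \<otimes>\<^bsub>?E\<^esub> y \<in> V k"
            using subgroup.m_closed[OF Vsub[OF k(1)]] VY one old by blast
          ultimately show ?thesis using VY[OF old] t by blast
        qed
      qed
    next
      show "inv\<^bsub>?E\<^esub> a \<in> Y (Suc k) \<or> (\<exists>b\<in>Y (Suc k). inv\<^bsub>?E\<^esub> a = a \<otimes>\<^bsub>?E\<^esub> b)"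
        if "a \<in> Y (Suc k)" for a
        by (rule Yinv[OF Suc.prems(1) that])
    qed (use xk in auto)
    then obtain h t where ht: "h \<in> V k" "t \<in> {\<one>\<^bsub>?E\<^esub>, x (Suc k)}" "y = h \<otimes>\<^bsub>?E\<^esub> t" by blast
    have hc: "h \<in> carrier ?E" using Vcl[OF k(1) ht(1)] .
    show ?case
    proof (cases "t = \<one>\<^bsub>?E\<^esub>")
      case True
      then have "y = h" using ht hc by simp
      then show ?thesis using Suc.IH[OF k(1)] ht Suc.prems by simp
    next
      case False
      then have t: "t = x (Suc k)" using ht by simp
      let ?l = "Suc (Suc k)"
      have l: "?l \<in> {1..Suc m}" using k by simp
      note cl = c_closed[OF l] e_closed[OF k(2)] z_closed h.hom_closed[OF hc]
      have one: "E_hom h \<otimes> e (Suc k) = \<one>"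
        using Suc.prems(3) hx[OF k(2)] hc xk by (simp add: ht(3) t)
      \<comment> \<open>\<open>E_hom h\<close> commutes with \<open>c ?l\<close> and
        \<open>e (Suc k)\<close> anticommutes with it, yet their product is \<open>\<one>\<close>;
        this forces \<open>z = \<one>\<close>.\<close>
      have "c ?l = E_hom h \<otimes> (e (Suc k) \<otimes> c ?l)" using cl one by (simp add: m_assoc[symmetric])
      also have "e (Suc k) \<otimes> c ?l = z \<otimes> (c ?l \<otimes> e (Suc k))" using e_c[OF k(2) l] by simp
      also have "E_hom h \<otimes> \<dots> = z \<otimes> (E_hom h \<otimes> c ?l \<otimes> e (Suc k))"
        using cl by (simp add: m_assoc z_left_commute)
      also have "E_hom h \<otimes> c ?l = c ?l \<otimes> E_hom h" using commute[OF k(1) ht(1)] l by simp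
      also have "c ?l \<otimes> E_hom h \<otimes> e (Suc k) = c ?l" using cl one by (simp add: m_assoc)
      finally have "\<one> \<otimes> c ?l = z \<otimes> c ?l" using cl by simp
      then have "z = \<one>" using cl by (metis one_closed right_cancel)
      then show ?thesis using z_neq by simp
    qed
  qed
  have "carrier ?E = generate ?E (g ` E_gens m)"
    unfolding g_def E_group_def by (rule carrier_presented_generate)
  moreover have "g ` E_gens m \<subseteq> Y m" by (auto simp: E_gens_def Y_def w_def x_def)
  ultimately have "carrier ?E \<subseteq> V m" unfolding V_def using E.mono_generate by metis
  then show ?thesis
    using inj[OF order.refl] by (intro h.inj_on_one_iff[THEN iffD2]) auto
qed

lemma short_exact:
  assumes "1 \<le> m"
  shows "short_exact_groups (E_group m (-1)) (G\<lparr>carrier := S\<rparr>) (sym_group (Suc m)) E_hom perm_of"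
proof -
  have "group (E_group m (-1))" unfolding E_group_def by (rule group_presented)
  moreover have "group (G\<lparr>carrier := S\<rparr>)"
    by (intro subgroup_imp_group generate_is_subgroup[OF S_gens_closed])
  moreover have "E_hom ` carrier (E_group m (-1)) \<subseteq> S"
    using E_hom_range N_subset_S[OF assms] by simp
  then have "E_hom \<in> mon (E_group m (-1)) (G\<lparr>carrier := S\<rparr>)"
    using E_hom_hom E_hom_inj by (auto simp: mon_def hom_def)
  ultimately show ?thesis
    unfolding short_exact_groups_def kernel_perm_of[OF assms] E_hom_range
    using sym_group_is_group perm_of_epi by blast
qed

end

section \<open>The image of the braid group\<close>

lemma minus_one_GL: "(-1) \<cdot>\<^sub>m 1\<^sub>m N \<in> carrier (GL N)"
proof -
  have "((-1) \<cdot>\<^sub>m 1\<^sub>m N) * ((-1) \<cdot>\<^sub>m 1\<^sub>m N) = (1\<^sub>m N :: complex mat)"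
    by (intro eq_matI) auto
  then show ?thesis unfolding GL_iff by (intro conjI bexI) auto
qed

text \<open>With \<open>n - 1\<close> for \<open>m\<close> there is one Majorana operator per tensor
  factor and one braid generator per pair of neighbouring factors.\<close>

lemma majorana_braiding_GL:
  assumes "2 \<le> n"
  shows "majorana_braiding (GL (2 ^ n)) ((-1) \<cdot>\<^sub>m 1\<^sub>m (2 ^ n)) (majorana n) (sigma_mat n) (n - 1)"
proof -
  let ?N = "2 ^ n" and ?z = "(-1) \<cdot>\<^sub>m 1\<^sub>m (2 ^ n) :: complex mat"
  have n: "Suc (n - 1) = n" using assms by simp
  have car: "A \<in> carrier_mat ?N ?N" if "A \<in> carrier (GL ?N)" for A using that by (simp add: GL_iff)
  have zl: "?z * A = (-1) \<cdot>\<^sub>m A" if "A \<in> carrier_mat ?N ?N" for A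
    using that by (simp add: mult_smult_assoc_mat[of _ ?N ?N _ ?N])
  have zr: "A * ?z = (-1) \<cdot>\<^sub>m A" if "A \<in> carrier_mat ?N ?N" for A
    using that by (simp add: mult_smult_distrib[of _ ?N ?N _ ?N])
  have mcar: "majorana n k \<in> carrier_mat ?N ?N" if "k \<in> {1..n}" for k
    using that majorana_carrier by simp
  have mGL: "majorana n k \<in> carrier (GL ?N)" if "k \<in> {1..n}" for k
    unfolding GL_iff using mcar[OF that] majorana_square[of k n] that by auto
  have scar: "sigma_mat n i \<in> carrier_mat ?N ?N" if "i \<in> {1..n-1}" for i
    using car sigma_mat_GL[OF that] .
  interpret group "GL ?N" by (rule group_GL)
  show ?thesis
  proof (unfold_locales, unfold mult_GL one_GL n)
    show "?z \<in> carrier (GL ?N)" by (rule minus_one_GL)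
    show "x * ?z = ?z * x" if "x \<in> carrier (GL ?N)" for x
      using zl zr car[OF that] by simp
    show "?z \<noteq> 1\<^sub>m ?N"
    proof
      assume "?z = 1\<^sub>m ?N"
      then have "?z $$ (0, 0) = 1\<^sub>m ?N $$ (0, 0)" by simp
      then show False by simp
    qed
    show "?z * ?z = 1\<^sub>m ?N" by (intro eq_matI) auto
    show "majorana n k \<in> carrier (GL ?N)" if "k \<in> {1..n}" for k using mGL[OF that] .
    show "majorana n k * majorana n k = 1\<^sub>m ?N" if "k \<in> {1..n}" for k
      using that majorana_square by simp
    show "majorana n j * majorana n k = ?z * (majorana n k * majorana n j)"
      if jk: "j \<in> {1..n}" "k \<in> {1..n}" "j \<noteq> k" for j k
    proof -
      have c: "majorana n j * majorana n k \<in> carrier_mat ?N ?N"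
        "majorana n k * majorana n j \<in> carrier_mat ?N ?N"
        using mcar[OF jk(1)] mcar[OF jk(2)] by simp_all
      consider "j < k" | "k < j" using jk by linarith
      then show ?thesis
      proof cases
        case 1
        then show ?thesis using majorana_anticommute[of j k n] jk zl[OF c(2)] by simp
      next
        case 2
        then have "majorana n k * majorana n j = (-1) \<cdot>\<^sub>m (majorana n j * majorana n k)"
          using majorana_anticommute[of k j n] jk by simp
        then show ?thesis using zl[OF c(2)] c(1) by (simp add: smult_smult_mat) (auto intro: eq_matI)
      qed
    qed
    show "sigma_mat n i \<in> carrier (GL ?N)" if "i \<in> {1..n-1}" for i using sigma_mat_GL[OF that] .
    show "sigma_mat n i * sigma_mat n i = majorana n i * majorana n (Suc i)"
      if "i \<in> {1..n-1}" for i
      using sigma_majorana(3)[of i n] that by auto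
    show "sigma_mat n i * majorana n i = ?z * (majorana n (Suc i) * sigma_mat n i)"
      if i: "i \<in> {1..n-1}" for i
    proof -
      have "Suc i \<in> {1..n}" using i by auto
      then have "majorana n (Suc i) * sigma_mat n i \<in> carrier_mat ?N ?N"
        by (intro mult_carrier_mat[of _ ?N ?N] mcar scar i)
      then show ?thesis using sigma_majorana(1)[of i n] i zl by auto
    qed
    show "sigma_mat n i * majorana n (Suc i) = majorana n i * sigma_mat n i"
      if "i \<in> {1..n-1}" for i
      using sigma_majorana(2)[of i n] that by auto
    show "sigma_mat n i * majorana n k = majorana n k * sigma_mat n i"
      if "i \<in> {1..n-1}" "k \<in> {1..n}" "k \<noteq> i" "k \<noteq> Suc i" for i k
      using sigma_majorana(4)[of i n k] that by auto
    show "sigma_mat n i * sigma_mat n j = sigma_mat n j * sigma_mat n i"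
      if "i \<in> {1..n-1}" "j \<in> {1..n-1}" "i + 2 \<le> j" for i j
      using sigma_mat_far[of i j n] that by auto
    show "sigma_mat n i * sigma_mat n (Suc i) * sigma_mat n i =
        sigma_mat n (Suc i) * sigma_mat n i * sigma_mat n (Suc i)"
      if "i \<in> {1..n-1}" "Suc i \<in> {1..n-1}" for i
      using sigma_mat_braid[of i n] that by auto
  qed
qed

text \<open>This identifies the braid image with the subgroup \<open>S\<close> to which
  \<open>short_exact\<close> refers.\<close>

lemma braid_image_generate:
  "braid_image n = (GL (2 ^ n))\<lparr>carrier := generate (GL (2 ^ n)) (sigma_mat n ` {1..n-1})\<rparr>"
proof -
  have "braid_rep n ` carrier (braid_group n) = generate (GL (2 ^ n)) (sigma_mat n ` {1..n-1})"
    unfolding braid_rep_def braid_group_def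
    by (rule group.pres_lift_image[OF group_GL _ sigma_mat_rels]) (use sigma_mat_GL in auto)
  then show ?thesis by (simp add: braid_image_def)
qed

theorem theorem4p2:
  fixes n :: nat
  assumes "n \<ge> 2"
  shows "\<exists>f g. short_exact_groups (E_group (n - 1) (-1)) (braid_image n) (sym_group n) f g"
proof -
  interpret majorana_braiding "GL (2 ^ n)" "(-1) \<cdot>\<^sub>m 1\<^sub>m (2 ^ n)" "majorana n" "sigma_mat n" "n - 1"
    by (rule majorana_braiding_GL[OF assms])
  have "1 \<le> n - 1" "Suc (n - 1) = n" using assms by simp_all
  then show ?thesis using short_exact unfolding braid_image_generate by metis
qed

end
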